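(* Suppose $u$ is a continuous complex-valued function on the closed quarter-plane $\mathbb{R}_{\ge0}\times\mathbb{R}_{\le0}$ which solves the Klein-Gordon equation $u''_{xy}+u=0$ in the sense of distribution theory in the interior quarter-plane $\mathbb{R}_{>0}\times\mathbb{R}_{<0}$. Suppose moreover that $u$ vanishes along the semi-axis $\{0\}\times\mathbb{R}_{\le0}$. Finally, assume that $u$ meets the uniform growth bound $$|u(x,y)|=\mathrm{O}\big(\exp(\theta_1 x+\theta_2|y|)\big),\qquad (x,y)\in\mathbb{R}_{\ge0}\times\mathcal{Y},$$ where $\theta_1,\theta_2\in\mathbb{R}_{>0}$ and the nonempty subset $\mathcal{Y}\subset\mathbb{R}_{\le0}$ has $0\in\mathcal{Y}$ and $\inf\mathcal{Y}=-\infty$. Then, if $\theta_1\theta_2<1$, it follows that $u(x,y)=0$ for all $(x,y)\in\mathbb{R}_{\ge0}\times\mathbb{R}_{\le0}$.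
   Context: Here $u''_{xy}=\partial_x\partial_y u$. The uniform growth bound means that there is a constant $C$, independent of $(x,y)$, such that $|u(x,y)|\le C\exp(\theta_1 x+\theta_2|y|)$ for all $(x,y)\in\mathbb{R}_{\ge0}\times\mathcal{Y}$. *)

theory Defs
  imports "HOL-Analysis.Analysis"
begin

definition partial_x :: "(real \<times> real \<Rightarrow> complex) \<Rightarrow> real \<times> real \<Rightarrow> complex" where
  "partial_x f = (\<lambda>(x, y). vector_derivative (\<lambda>t. f (t, y)) (at x))"

definition partial_y :: "(real \<times> real \<Rightarrow> complex) \<Rightarrow> real \<times> real \<Rightarrow> complex" where
  "partial_y f = (\<lambda>(x, y). vector_derivative (\<lambda>t. f (x, t)) (at y))"

primrec Ck_plane :: "nat \<Rightarrow> (real \<times> real \<Rightarrow> complex) \<Rightarrow> bool" where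
  "Ck_plane 0 f \<longleftrightarrow> continuous_on UNIV f"
| "Ck_plane (Suc k) f \<longleftrightarrow>
     continuous_on UNIV f \<and>
     (\<forall>x y. (\<lambda>t. f (t, y)) differentiable (at x)) \<and>
     (\<forall>x y. (\<lambda>t. f (x, t)) differentiable (at y)) \<and>
     Ck_plane k (partial_x f) \<and> Ck_plane k (partial_y f)"

definition smooth_plane :: "(real \<times> real \<Rightarrow> complex) \<Rightarrow> bool" where
  "smooth_plane f \<longleftrightarrow> (\<forall>k. Ck_plane k f)"

(* Test functions on \<Omega> are represented by their extensions by zero to the whole plane. *)
definition test_function :: "(real \<times> real) set \<Rightarrow> (real \<times> real \<Rightarrow> complex) \<Rightarrow> bool" where
  "test_function \<Omega> \<phi> \<longleftrightarrow>
     smooth_plane \<phi> \<and> compact (closure {p. \<phi> p \<noteq> 0}) \<and> closure {p. \<phi> p \<noteq> 0} \<subseteq> \<Omega>"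

(* Distributions are represented by their action on functions; only the values on
   test functions are meaningful. The pairing is bilinear (no complex conjugation). *)
definition dist_of ::
    "(real \<times> real) set \<Rightarrow> (real \<times> real \<Rightarrow> complex) \<Rightarrow> (real \<times> real \<Rightarrow> complex) \<Rightarrow> complex" where
  "dist_of \<Omega> u \<phi> = (LINT p:\<Omega>|lborel. u p * \<phi> p)"

definition dist_partial_x ::
    "((real \<times> real \<Rightarrow> complex) \<Rightarrow> complex) \<Rightarrow> (real \<times> real \<Rightarrow> complex) \<Rightarrow> complex" where
  "dist_partial_x T \<phi> = - T (partial_x \<phi>)"

definition dist_partial_y ::
    "((real \<times> real \<Rightarrow> complex) \<Rightarrow> complex) \<Rightarrow> (real \<times> real \<Rightarrow> complex) \<Rightarrow> complex" where
  "dist_partial_y T \<phi> = - T (partial_y \<phi>)"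

definition klein_gordon_dist :: "(real \<times> real) set \<Rightarrow> (real \<times> real \<Rightarrow> complex) \<Rightarrow> bool" where
  "klein_gordon_dist \<Omega> u \<longleftrightarrow>
     (\<forall>\<phi>. test_function \<Omega> \<phi> \<longrightarrow>
        dist_partial_x (dist_partial_y (dist_of \<Omega> u)) \<phi> + dist_of \<Omega> u \<phi> = 0)"

end

theory Submission
  imports Defs "HOL-Complex_Analysis.Complex_Analysis"
begin

text \<open>
  Put \<open>v(x, s) = u(x, - s)\<close>. Testing the equation against products of smoothed indicators gives
  the Goursat integral equation \<open>v(x, s) = v(x, 0) + \<integral>\<integral> v\<close> over \<open>[0, x] \<times> [0, s]\<close>. A weighted
  supremum estimate turns the bound on \<open>v(x, 0)\<close> into \<open>v(x, s) = O(exp (\<alpha> x + \<beta> s))\<close> for any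
  \<open>\<alpha> > \<theta>1\<close> and \<open>\<beta> > 1 / \<alpha>\<close>, so the Laplace transform \<open>V(l, s)\<close> in \<open>x\<close> exists for all \<open>l > \<theta>1\<close> and
  all \<open>s\<close>, and the equation becomes \<open>V(l, s) = exp (s / l) V(l, 0)\<close>. Along \<open>- s \<in> Y\<close>, \<open>V(l, s)\<close> is
  \<open>O(exp (\<theta>2 s))\<close>; since \<open>\<theta>1 \<theta>2 < 1\<close> there are \<open>l > \<theta>1\<close> with \<open>1 / l > \<theta>2\<close>, and for these
  \<open>V(l, 0) = 0\<close>. As \<open>V(\<cdot>, 0)\<close> is holomorphic it vanishes identically, so \<open>v(\<cdot>, 0) = 0\<close> and then
  \<open>v = 0\<close>.
\<close>

section \<open>Smooth product functions\<close>

text \<open>The derivative is an explicit witness function, so closure under sums, products and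
  affine substitutions follows by induction on \<open>k\<close>. The recursion runs parallel to
  \<open>Ck_plane\<close>, as \<open>Ck_plane_product\<close> requires.\<close>

primrec Ck_real :: "nat \<Rightarrow> (real \<Rightarrow> real) \<Rightarrow> bool" where
  "Ck_real 0 f \<longleftrightarrow> continuous_on UNIV f"
| "Ck_real (Suc k) f \<longleftrightarrow> (\<exists>f'. (\<forall>x. (f has_real_derivative f' x) (at x)) \<and> Ck_real k f')"

definition smooth_real :: "(real \<Rightarrow> real) \<Rightarrow> bool" where
  "smooth_real f \<longleftrightarrow> (\<forall>k. Ck_real k f)"

lemma Ck_real_continuous: "Ck_real k f \<Longrightarrow> continuous_on UNIV f"
  by (cases k) (auto intro: DERIV_continuous_on)

lemma Ck_real_SucD: "Ck_real (Suc k) f \<Longrightarrow> Ck_real k f"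
proof (induction k arbitrary: f)
  case 0
  then show ?case using Ck_real_continuous by (metis Ck_real.simps(1))
next
  case (Suc k)
  then show ?case by (metis Ck_real.simps(2))
qed

lemma Ck_real_const: "Ck_real k (\<lambda>x. c)"
proof (induction k arbitrary: c)
  case (Suc k)
  then show ?case by (auto intro!: exI[of _ "\<lambda>x. 0"])
qed auto

lemma Ck_real_add: "Ck_real k f \<Longrightarrow> Ck_real k g \<Longrightarrow> Ck_real k (\<lambda>x. f x + g x)"
proof (induction k arbitrary: f g)
  case (Suc k)
  then obtain f' g' where *: "\<forall>x. (f has_real_derivative f' x) (at x)" "Ck_real k f'"
    "\<forall>x. (g has_real_derivative g' x) (at x)" "Ck_real k g'" by auto
  then have "\<forall>x. ((\<lambda>x. f x + g x) has_real_derivative f' x + g' x) (at x)"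
    using DERIV_add by blast
  then show ?case using Suc.IH[of f' g'] *
    unfolding Ck_real.simps by (intro exI[of _ "\<lambda>x. f' x + g' x"] conjI)
qed (auto intro!: continuous_intros)

lemma Ck_real_mult: "Ck_real k f \<Longrightarrow> Ck_real k g \<Longrightarrow> Ck_real k (\<lambda>x. f x * g x)"
proof (induction k arbitrary: f g)
  case (Suc k)
  then obtain f' g' where *: "\<forall>x. (f has_real_derivative f' x) (at x)" "Ck_real k f'"
    "\<forall>x. (g has_real_derivative g' x) (at x)" "Ck_real k g'" by auto
  have "Ck_real k (\<lambda>x. f' x * g x + g' x * f x)"
    by (rule Ck_real_add[OF Suc.IH[OF *(2) Suc.prems(2)[THEN Ck_real_SucD]]
          Suc.IH[OF *(4) Suc.prems(1)[THEN Ck_real_SucD]]])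
  moreover have "\<forall>x. ((\<lambda>x. f x * g x) has_real_derivative f' x * g x + g' x * f x) (at x)"
    using * DERIV_mult by blast
  ultimately show ?case unfolding Ck_real.simps by (intro exI[of _ "\<lambda>x. f' x * g x + g' x * f x"] conjI)
qed (auto intro!: continuous_intros)

lemma Ck_real_affine: "Ck_real k f \<Longrightarrow> Ck_real k (\<lambda>x. f (c * x + d))"
proof (induction k arbitrary: f)
  case 0
  then have "continuous_on UNIV f" by simp
  then have "continuous_on UNIV (\<lambda>x. f (c * x + d))"
    by (rule continuous_on_compose2) (auto intro!: continuous_intros)
  then show ?case by simp
next
  case (Suc k)
  then obtain f' where *: "\<forall>x. (f has_real_derivative f' x) (at x)" "Ck_real k f'" by auto
  have "Ck_real k (\<lambda>x. f' (c * x + d) * c)"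
    by (rule Ck_real_mult[OF Suc.IH[OF *(2)] Ck_real_const])
  moreover have "((\<lambda>x. f (c * x + d)) has_real_derivative f' (c * x + d) * c) (at x)" for x
    by (rule DERIV_chain'[where f = "\<lambda>x. c * x + d"]) (use * in \<open>auto intro!: derivative_eq_intros\<close>)
  ultimately show ?case unfolding Ck_real.simps by (intro exI[of _ "\<lambda>x. f' (c * x + d) * c"] conjI allI)
qed

lemma smooth_real_antiderivative:
  assumes "\<And>x. (f has_real_derivative f' x) (at x)" "smooth_real f'"
  shows "smooth_real f"
  unfolding smooth_real_def
proof
  fix k
  have "Ck_real (Suc k) f" using assms by (auto simp: smooth_real_def)
  then show "Ck_real k f" by (rule Ck_real_SucD)
qed

text \<open>The classical flat function is the case \<open>p = 1\<close>. Polynomial factors in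
  \<open>1 / x\<close> are included because the family is then closed under differentiation, which
  turns smoothness into a plain induction.\<close>

definition flat :: "real poly \<Rightarrow> real \<Rightarrow> real" where
  "flat p x = (if x > 0 then poly p (1 / x) * exp (- (1 / x)) else 0)"

lemma poly_div_exp_tendsto_0: "((\<lambda>t::real. poly p t * exp (- t)) \<longlongrightarrow> 0) at_top"
proof -
  have "((\<lambda>t. \<Sum>i\<le>degree p. coeff p i * (t ^ i / exp t)) \<longlongrightarrow> (\<Sum>i\<le>degree p. coeff p i * 0)) at_top"
    by (intro tendsto_intros tendsto_power_div_exp_0)
  then show ?thesis
    by (simp add: poly_altdef sum_distrib_right exp_minus divide_inverse mult.assoc)
qed

lemma flat_tendsto_0: "(flat p \<longlongrightarrow> 0) (at 0)"
proof -
  have "((\<lambda>x. poly p (1 / x) * exp (- (1 / x))) \<longlongrightarrow> 0) (at_right 0)"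
    using filterlim_compose[OF poly_div_exp_tendsto_0 filterlim_inverse_at_top_right, of p]
    by (simp add: inverse_eq_divide)
  moreover have "\<forall>\<^sub>F x in at_right 0. poly p (1 / x) * exp (- (1 / x)) = flat p x"
    by (auto simp: flat_def eventually_at_right_less eventually_at intro: exI[of _ 1])
  ultimately have "(flat p \<longlongrightarrow> 0) (at_right 0)"
    by (rule Lim_transform_eventually)
  moreover have "\<forall>\<^sub>F x in at_left 0. 0 = flat p x"
    by (auto simp: flat_def eventually_at intro: exI[of _ 1])
  then have "(flat p \<longlongrightarrow> 0) (at_left 0)"
    using Lim_transform_eventually tendsto_const by blast
  ultimately show ?thesis by (simp add: filterlim_at_split)
qed

text \<open>With \<open>t = 1 / x\<close>, whose derivative is \<open>- t^2\<close>, the product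
  rule turns \<open>p(t) exp(- t)\<close> into \<open>t^2 (p(t) - p'(t)) exp(- t)\<close>.\<close>

lemma flat_derivative:
  "(flat p has_real_derivative flat (monom 1 2 * (p - pderiv p)) x) (at x)"
proof -
  consider "x > 0" | "x < 0" | "x = 0" by linarith
  then show ?thesis
  proof cases
    case 1
    have "((\<lambda>x. poly p (1 / x) * exp (- (1 / x))) has_real_derivative
           flat (monom 1 2 * (p - pderiv p)) x) (at x)"
      using 1 by (auto intro!: derivative_eq_intros DERIV_chain'[where f = "\<lambda>x. 1 / x" and g = "poly p"] poly_DERIV
          simp: flat_def poly_monom power2_eq_square field_simps)
    then show ?thesis
      by (rule DERIV_cong_ev[THEN iffD1, rotated -1])
        (use 1 in \<open>auto simp: flat_def eventually_nhds intro!: exI[of _ "{0<..}"]\<close>)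
  next
    case 2
    have "((\<lambda>x. 0) has_real_derivative flat (monom 1 2 * (p - pderiv p)) x) (at x)"
      using 2 by (simp add: flat_def)
    then show ?thesis
      by (rule DERIV_cong_ev[THEN iffD1, rotated -1])
        (use 2 in \<open>auto simp: flat_def eventually_nhds intro!: exI[of _ "{..<0}"]\<close>)
  next
    case 3
    \<comment> \<open>Dividing by \<open>h\<close> raises each power of \<open>1 / h\<close> by one,
      so the difference quotient stays in the family and tends to 0.\<close>
    have "(\<lambda>h. (flat p (0 + h) - flat p 0) / h) = flat (monom 1 1 * p)"
      by (auto simp: flat_def poly_monom)
    then show ?thesis
      using flat_tendsto_0[of "monom 1 1 * p"] 3
      by (simp add: DERIV_def flat_def[of _ 0])
  qed
qed

lemma smooth_flat: "smooth_real (flat p)"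
proof -
  have "Ck_real k (flat p)" for k
  proof (induction k arbitrary: p)
    case 0
    then show ?case
      using flat_derivative[of p] by (auto intro!: DERIV_continuous_on intro: has_field_derivative_at_within)
  next
    case (Suc k)
    then show ?case using flat_derivative[of p] by auto
  qed
  then show ?thesis by (simp add: smooth_real_def)
qed

text \<open>The bump \<open>flat 1 x * flat 1 (1 - x)\<close> divided by its integral serves as
  \<rho>, and its primitive as \<open>R\<close>. Later \<open>R\<close> smooths the edges of
  indicators, and \<rho> is the mollifier that appears on differentiating them.\<close>

lemma smooth_step_exists:
  obtains R \<rho> :: "real \<Rightarrow> real" where
    "\<And>x. (R has_real_derivative \<rho> x) (at x)" "smooth_real \<rho>" "\<And>x. 0 \<le> \<rho> x"
    "\<And>x. x \<le> 0 \<Longrightarrow> \<rho> x = 0" "\<And>x. 1 \<le> x \<Longrightarrow> \<rho> x = 0"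
    "\<And>x. x \<le> 0 \<Longrightarrow> R x = 0" "\<And>x. 1 \<le> x \<Longrightarrow> R x = 1"
proof -
  define B where "B = (\<lambda>x. flat 1 x * flat 1 (1 - x))"
  have B0: "B x = 0" if "x \<le> 0 \<or> 1 \<le> x" for x using that by (auto simp: B_def flat_def)
  have Bnn: "0 \<le> B x" for x by (auto simp: B_def flat_def)
  have "Ck_real k B" for k
    unfolding B_def using smooth_flat[of 1] Ck_real_affine[of k "flat 1" "-1" 1]
    by (intro Ck_real_mult) (auto simp: smooth_real_def algebra_simps)
  then have cont: "continuous_on S B" and smB: "smooth_real B" for S
    using Ck_real_continuous[of 0 B] continuous_on_subset[of UNIV B S] by (simp_all add: smooth_real_def del: Ck_real.simps)
  define c where "c = integral {0..1} B"
  have "c \<noteq> 0"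
  proof
    assume "c = 0"
    then have "\<And>x. x \<in> {0..1} \<Longrightarrow> B x = 0"
      using integral_eq_0_iff[OF cont, of 0 1] Bnn by (auto simp: c_def)
    then have "B (1/2) = 0" by simp
    then show False by (simp add: B_def flat_def)
  qed
  have "c \<ge> 0" unfolding c_def using Bnn by (intro integral_nonneg integrable_continuous_real cont) auto
  with \<open>c \<noteq> 0\<close> have c: "c > 0" by simp
  \<comment> \<open>For negative \<open>x\<close> the interval is empty, so \<open>I\<close> is 0
    there by default.\<close>
  define I where "I = (\<lambda>x. integral {0..x} B)"
  have I0: "I x = 0" if "x \<le> 0" for x
    using that by (cases "x = 0") (auto simp: I_def)
  have I1: "I x = c" if "x \<ge> 1" for x
  proof -
    have "integral {0..1} B + integral {1..x} B = I x"
      unfolding I_def by (rule Henstock_Kurzweil_Integration.integral_combine) (use that in \<open>auto intro: integrable_continuous_real cont\<close>)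
    moreover have "integral {1..x} B = 0"
      by (intro integral_unique has_integral_is_0) (auto simp: B0)
    ultimately show ?thesis by (simp add: c_def)
  qed
  \<comment> \<open>Starting at \<open>-1\<close>, where \<open>B\<close> still vanishes, makes
    every \<open>x \<ge> 0\<close> an interior point, so that differentiation within an interval
    gives the two-sided derivative.\<close>
  have II: "I y = integral {-1..y} B" if "y \<ge> -1" for y
  proof (cases "y \<ge> 0")
    case True
    have "integral {-1..0} B + integral {0..y} B = integral {-1..y} B"
      by (rule Henstock_Kurzweil_Integration.integral_combine) (use True in \<open>auto intro: integrable_continuous_real cont\<close>)
    moreover have "integral {-1..0} B = 0"
      by (intro integral_unique has_integral_is_0) (auto simp: B0)
    ultimately show ?thesis by (simp add: I_def)
  next
    case False
    have "integral {-1..y} B = 0"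
      by (intro integral_unique has_integral_is_0) (use False in \<open>auto simp: B0\<close>)
    then show ?thesis using False by (simp add: I0)
  qed
  have dI: "(I has_real_derivative B x) (at x)" for x
  proof (cases "x < 0")
    case True
    have "((\<lambda>x. 0) has_real_derivative B x) (at x)" using True by (simp add: B0)
    then show ?thesis
      by (rule DERIV_cong_ev[THEN iffD1, rotated -1])
        (use True in \<open>auto simp: I0 eventually_nhds intro!: exI[of _ "{..<0}"]\<close>)
  next
    case False
    have "((\<lambda>y. integral {-1..y} B) has_real_derivative B x) (at x within {-1..x+1})"
      by (rule integral_has_real_derivative) (use False in \<open>auto intro: cont\<close>)
    moreover have "at x within {-1..x+1} = at x"
      using False by (intro at_within_interior) auto
    ultimately have "((\<lambda>y. integral {-1..y} B) has_real_derivative B x) (at x)" by simp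
    then show ?thesis
      by (rule DERIV_cong_ev[THEN iffD1, rotated -1])
        (use False II in \<open>auto simp: eventually_nhds intro!: exI[of _ "{-1<..}"]\<close>)
  qed
  have "smooth_real (\<lambda>x. inverse c * B x)"
    using smB by (auto simp: smooth_real_def simp del: Ck_real.simps intro!: Ck_real_mult Ck_real_const)
  moreover have "((\<lambda>x. inverse c * I x) has_real_derivative inverse c * B x) (at x)" for x
    by (auto intro!: derivative_eq_intros dI)
  ultimately show ?thesis
    using that[of "\<lambda>x. inverse c * I x" "\<lambda>x. inverse c * B x"] c Bnn B0 I0 I1
    by auto
qed

section \<open>Products of one-variable functions as smooth functions on the plane\<close>

lemma continuous_on_product_of_real:
  assumes "continuous_on UNIV a" "continuous_on UNIV b"
  shows "continuous_on S (\<lambda>p. of_real (a (fst p) * b (snd p)) :: complex)"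
proof -
  have "continuous_on S (\<lambda>p. a (fst p))" "continuous_on S (\<lambda>p. b (snd p))"
    using assms by (auto intro!: continuous_on_compose2[of UNIV a] continuous_on_compose2[of UNIV b]
        continuous_on_fst continuous_on_snd continuous_on_id)
  then show ?thesis by (intro continuous_intros)
qed

lemma partial_x_product:
  assumes "\<And>x. (a has_real_derivative a' x) (at x)"
  shows "partial_x (\<lambda>(x, y). of_real (a x * b y)) = (\<lambda>(x, y). of_real (a' x * b y))"
proof -
  have "((\<lambda>t. of_real (a t * b y) :: complex) has_vector_derivative of_real (a' x * b y)) (at x)" for x y
    by (intro has_vector_derivative_of_real DERIV_cmult_right assms)
  then show ?thesis unfolding partial_x_def by (auto simp: fun_eq_iff intro: vector_derivative_at)
qed

lemma partial_y_product:
  assumes "\<And>y. (b has_real_derivative b' y) (at y)"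
  shows "partial_y (\<lambda>(x, y). of_real (a x * b y)) = (\<lambda>(x, y). of_real (a x * b' y))"
proof -
  have "((\<lambda>t. of_real (a x * b t) :: complex) has_vector_derivative of_real (a x * b' y)) (at y)" for x y
    by (intro has_vector_derivative_of_real DERIV_cmult assms)
  then show ?thesis unfolding partial_y_def by (auto simp: fun_eq_iff intro: vector_derivative_at)
qed

text \<open>Both partial derivatives of a product are again products with one factor differentiated,
  hence the induction over all pairs \<open>a\<close>, \<open>b\<close>.\<close>

lemma Ck_plane_product:
  "Ck_real k a \<Longrightarrow> Ck_real k b \<Longrightarrow> Ck_plane k (\<lambda>(x, y). of_real (a x * b y))"
proof (induction k arbitrary: a b)
  case 0
  then have "continuous_on UNIV (\<lambda>p. of_real (a (fst p) * b (snd p)) :: complex)"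
    by (intro continuous_on_product_of_real) auto
  then show ?case by (simp add: case_prod_beta')
next
  case (Suc k)
  then obtain a' b' where *: "\<And>x. (a has_real_derivative a' x) (at x)" "Ck_real k a'"
    "\<And>x. (b has_real_derivative b' x) (at x)" "Ck_real k b'" by auto
  have c: "continuous_on UNIV a" "continuous_on UNIV b"
    using Suc.prems Ck_real_continuous by blast+
  have k: "Ck_real k a" "Ck_real k b" using Suc.prems Ck_real_SucD by blast+
  have cc: "continuous_on UNIV (\<lambda>p. of_real (a (fst p) * b (snd p)) :: complex)"
    using c by (intro continuous_on_product_of_real)
  have dx: "((\<lambda>t. of_real (a t * b y) :: complex) has_vector_derivative of_real (a' x * b y)) (at x)" for x y
    by (intro has_vector_derivative_of_real DERIV_cmult DERIV_cmult_right *)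
  have dy: "((\<lambda>t. of_real (a x * b t) :: complex) has_vector_derivative of_real (a x * b' y)) (at y)" for x y
    by (intro has_vector_derivative_of_real DERIV_cmult DERIV_cmult_right *)
  then show ?case
    using cc Suc.IH[OF *(2) k(2)] Suc.IH[OF k(1) *(4)] differentiableI_vector[OF dx] differentiableI_vector[OF dy]
      partial_x_product[of a a' b] partial_y_product[of b b' a] *
    by (simp add: case_prod_beta' del: of_real_mult)
qed

section \<open>From the distributional equation to the integral equation\<close>

text \<open>Passes from the Lebesgue integrals of the distributional pairing to integrals over a
  box, where iterated integration and the fundamental theorem of calculus apply.\<close>

lemma LINT_eq_integral_cbox:
  fixes g :: "real \<times> real \<Rightarrow> complex"
  assumes "continuous_on (cbox a b) g" "cbox a b \<subseteq> \<Omega>" "\<And>p. p \<in> \<Omega> \<Longrightarrow> p \<notin> cbox a b \<Longrightarrow> g p = 0"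
  shows "(LINT p:\<Omega>|lborel. g p) = integral (cbox a b) g"
proof -
  have "(LINT p:\<Omega>|lborel. g p) = (LINT p:cbox a b|lborel. g p)"
    unfolding set_lebesgue_integral_def
    using assms by (intro Bochner_Integration.integral_cong) (auto simp: indicator_def)
  also have "\<dots> = integral (cbox a b) g"
  proof (rule set_borel_integral_eq_integral)
    show "set_integrable lborel (cbox a b) g"
      unfolding set_integrable_def by (intro borel_integrable_compact assms) auto
  qed
  finally show ?thesis .
qed

text \<open>The kernel is the product of two bumps of mass one, of width \<open>1 / n\<close>, that lie in the open
  quarter-plane even if \<open>(p, - q)\<close> is on its boundary.\<close>

lemma mollifier_tendsto:
  fixes u :: "real \<times> real \<Rightarrow> complex"
  assumes u: "continuous_on ({0..} \<times> {..0}) u"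
    and R: "\<And>x. (R has_real_derivative \<rho> x) (at x)" "continuous_on UNIV \<rho>" "\<And>x. 0 \<le> \<rho> x"
      "\<And>x. x \<le> 0 \<Longrightarrow> \<rho> x = 0" "\<And>x. 1 \<le> x \<Longrightarrow> \<rho> x = 0" "R 0 = 0" "R 1 = 1"
    and pq: "p \<ge> 0" "q \<ge> 0"
  defines "K \<equiv> \<lambda>n z. real n * \<rho> (real n * (fst z - p) - 1) * (real n * \<rho> (real n * (- snd z - q) - 1))"
  shows "(\<lambda>n. LINT z:{0<..} \<times> {..<0}|lborel. u z * of_real (K n z)) \<longlonglongrightarrow> u (p, - q)"
proof (rule LIMSEQ_I)
  fix e :: real assume "e > 0"
  have "continuous (at (p, - q) within {0..} \<times> {..0}) u"
    using u pq by (auto simp: continuous_on_eq_continuous_within)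
  then obtain d where d: "d > 0" and ud: "\<And>z. z \<in> {0..} \<times> {..0} \<Longrightarrow> dist z (p, - q) < d \<Longrightarrow> cmod (u z - u (p, - q)) < e / 2"
    using \<open>e > 0\<close> unfolding continuous_within_eps_delta
    by (auto simp: dist_norm[of "u _"] dest!: spec[of _ "e / 2"])
  \<comment> \<open>Points of the kernel's support differ from \<open>(p, - q)\<close> by at most
    \<open>2 / n\<close> in each coordinate, hence the requirement \<open>4 / N < d\<close>.\<close>
  obtain N :: nat where N4: "4 / d < real N" using reals_Archimedean2 by blast
  moreover have "4 / d > 0" using d by simp
  ultimately have "real N > 0" by linarith
  with N4 d have N: "N > 0" "4 / real N < d" by (simp_all add: field_simps)
  have "cmod ((LINT z:{0<..} \<times> {..<0}|lborel. u z * of_real (K n z)) - u (p, - q)) < e" if "n \<ge> N" for n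
  proof -
    have n: "real n > 0" using N that by simp
    \<comment> \<open>The kernel lives where both arguments of \<rho> lie in \<open>{0..1}\<close>.
      Solving for the coordinates gives this box, which keeps a distance of at least
      \<open>1 / n\<close> from the axes.\<close>
    define A where "A = (p + 1 / n, - q - 2 / n)"
    define B where "B = (p + 2 / n, - q - 1 / n)"
    have box: "cbox A B = {p + 1 / n..p + 2 / n} \<times> {- q - 2 / n..- q - 1 / n}"
      by (simp add: A_def B_def cbox_Pair_eq)
    have sub: "cbox A B \<subseteq> {0<..} \<times> {..<0}"
    proof -
      have "1 / real n > 0" using n by simp
      then have "p + 1 / n > 0" "- q - 1 / n < 0" using pq by linarith+
      then show ?thesis unfolding box by force
    qed
    have contK: "continuous_on S (\<lambda>z. K n z)" for S
      unfolding K_def by (intro continuous_intros continuous_on_compose2[OF R(2)]) auto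
    have contu: "continuous_on (cbox A B) u"
      by (rule continuous_on_subset[OF u]) (use sub in force)
    have K0: "K n z = 0" if "z \<notin> cbox A B" for z
    proof -
      have "n * (fst z - p) - 1 \<le> 0 \<or> n * (fst z - p) - 1 \<ge> 1 \<or> n * (- snd z - q) - 1 \<le> 0 \<or> n * (- snd z - q) - 1 \<ge> 1"
        using that n unfolding box by (cases z) (auto simp: field_simps not_le)
      then show ?thesis using R(4,5) by (auto simp: K_def)
    qed
    have Knn: "0 \<le> K n z" for z using R(3) by (simp add: K_def)
    \<comment> \<open>Iterated integration splits the mass into two factors, each the increment of
      \<open>R\<close> from 0 to 1.\<close>
    have "integral (cbox A B) (K n) = 1"
    proof -
      have "integral (cbox A B) (K n) = integral (cbox (p + 1 / n) (p + 2 / n))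
          (\<lambda>x. integral (cbox (- q - 2 / n) (- q - 1 / n)) (\<lambda>y. K n (x, y)))"
        unfolding A_def B_def by (intro integral_prod_continuous contK)
      also have "\<dots> = integral {p + 1 / n..p + 2 / n} (\<lambda>x. n * \<rho> (n * (x - p) - 1)) *
          integral {- q - 2 / n..- q - 1 / n} (\<lambda>y. n * \<rho> (n * (- y - q) - 1))"
        by (simp add: K_def mult.assoc)
      also have "integral {p + 1 / n..p + 2 / n} (\<lambda>x. n * \<rho> (n * (x - p) - 1)) = R (n * (p + 2 / n - p) - 1) - R (n * (p + 1 / n - p) - 1)"
      proof (intro integral_unique fundamental_theorem_of_calculus)
        show "((\<lambda>x. R (n * (x - p) - 1)) has_vector_derivative n * \<rho> (n * (x - p) - 1)) (at x within {p + 1 / n..p + 2 / n})" for x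
          unfolding has_real_derivative_iff_has_vector_derivative[symmetric]
          by (rule DERIV_chain'[OF _ R(1), THEN DERIV_cong]) ((rule derivative_eq_intros refl)+, simp)
      qed (use n in \<open>simp add: field_simps\<close>)
      also have "integral {- q - 2 / n..- q - 1 / n} (\<lambda>y. n * \<rho> (n * (- y - q) - 1)) =
         - R (n * (- (- q - 1 / n) - q) - 1) - - R (n * (- (- q - 2 / n) - q) - 1)"
      proof (intro integral_unique fundamental_theorem_of_calculus[where f = "\<lambda>y. - R (n * (- y - q) - 1)"])
        show "((\<lambda>y. - R (n * (- y - q) - 1)) has_vector_derivative n * \<rho> (n * (- x - q) - 1)) (at x within {- q - 2 / n..- q - 1 / n})" for x
          unfolding has_real_derivative_iff_has_vector_derivative[symmetric]
          by (rule DERIV_minus[OF DERIV_chain'[OF _ R(1)], THEN DERIV_cong]) ((rule derivative_eq_intros refl)+, simp)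
      qed (use n in \<open>simp add: field_simps\<close>)
      finally show ?thesis using n R(6,7) by (simp add: right_diff_distrib)
    qed
    moreover have "integral (cbox A B) (\<lambda>z. complex_of_real (K n z)) = of_real (integral (cbox A B) (K n))"
      using integral_linear[OF integrable_continuous[OF contK] bounded_linear_of_real] by (simp add: o_def)
    then have "integral (cbox A B) (\<lambda>z. u (p, - q) * of_real (K n z)) = u (p, - q) * of_real (integral (cbox A B) (K n))"
      by simp
    moreover have "(LINT z:{0<..} \<times> {..<0}|lborel. u z * of_real (K n z)) = integral (cbox A B) (\<lambda>z. u z * of_real (K n z))"
      by (intro LINT_eq_integral_cbox continuous_intros contu contK sub) (auto simp: K0)
    \<comment> \<open>As the kernel has mass one, \<open>u (p, - q)\<close> is the integral of a
      constant against it. What remains is controlled by the oscillation of \<open>u\<close> on the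
      box.\<close>
    ultimately have "(LINT z:{0<..} \<times> {..<0}|lborel. u z * of_real (K n z)) - u (p, - q) =
        integral (cbox A B) (\<lambda>z. u z * of_real (K n z)) - integral (cbox A B) (\<lambda>z. u (p, - q) * of_real (K n z))"
      by simp
    also have "\<dots> = integral (cbox A B) (\<lambda>z. u z * of_real (K n z) - u (p, - q) * of_real (K n z))"
      by (intro Henstock_Kurzweil_Integration.integral_diff[symmetric] integrable_continuous continuous_intros contu contK)
    also have "cmod \<dots> \<le> integral (cbox A B) (\<lambda>z. e / 2 * K n z)"
    proof (rule integral_norm_bound_integral)
      fix z assume z: "z \<in> cbox A B"
      have "dist z (p, - q) \<le> \<bar>fst z - p\<bar> + \<bar>snd z + q\<bar>"
        using sqrt_sum_squares_le_sum_abs[of "fst z - p" "snd z + q"] by (cases z) (simp add: dist_Pair_Pair dist_real_def)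
      also have "\<dots> \<le> 2 / n + 2 / n"
        using z n unfolding box by (auto simp: abs_if)
      also have "\<dots> \<le> 4 / N" using N(1) that n by (simp add: field_simps)
      also have "\<dots> < d" by (fact N(2))
      finally have "cmod (u z - u (p, - q)) < e / 2" using z sub by (intro ud) force+
      then have "cmod (u z - u (p, - q)) * K n z \<le> e / 2 * K n z"
        by (intro mult_right_mono Knn) simp
      then show "cmod (u z * of_real (K n z) - u (p, - q) * of_real (K n z)) \<le> e / 2 * K n z"
        using Knn by (simp add: norm_mult abs_of_nonneg flip: left_diff_distrib)
    qed (intro integrable_continuous continuous_intros contu contK)+
    also have "\<dots> = e / 2" using \<open>integral (cbox A B) (K n) = 1\<close> by simp
    finally show ?thesis using \<open>e > 0\<close> by simp
  qed
  then show "\<exists>N. \<forall>n\<ge>N. cmod ((LINT z:{0<..} \<times> {..<0}|lborel. u z * of_real (K n z)) - u (p, - q)) < e"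
    by blast
qed

text \<open>Integrals over an unbounded region can be split into sums only once each part is known
  to exist; continuity on a compact box that carries the integrand provides this.\<close>

lemma set_integrable_cbox_support:
  fixes g :: "real \<times> real \<Rightarrow> complex"
  assumes "continuous_on (cbox a b) g" "cbox a b \<subseteq> \<Omega>" "\<And>p. p \<in> \<Omega> \<Longrightarrow> p \<notin> cbox a b \<Longrightarrow> g p = 0"
  shows "set_integrable lborel \<Omega> g"
proof -
  have "integrable lborel (\<lambda>p. indicator (cbox a b) p *\<^sub>R g p)"
    by (intro borel_integrable_compact assms) auto
  also have "(\<lambda>p. indicator (cbox a b) p *\<^sub>R g p) = (\<lambda>p. indicator \<Omega> p *\<^sub>R g p)"
    using assms by (auto simp: indicator_def fun_eq_iff)
  finally show ?thesis by (simp add: set_integrable_def)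
qed

lemma test_function_product:
  assumes "smooth_real a" "smooth_real b"
    and "\<And>x. a x \<noteq> 0 \<Longrightarrow> x \<in> {x0..x1}" "\<And>y. b y \<noteq> 0 \<Longrightarrow> y \<in> {y0..y1}"
    and "{x0..x1} \<times> {y0..y1} \<subseteq> \<Omega>"
  shows "test_function \<Omega> (\<lambda>(x, y). of_real (a x * b y))"
proof -
  let ?\<phi> = "\<lambda>(x, y). complex_of_real (a x * b y)"
  have "{p. ?\<phi> p \<noteq> 0} \<subseteq> {x0..x1} \<times> {y0..y1}"
    using assms(3,4) by force
  then have "closure {p. ?\<phi> p \<noteq> 0} \<subseteq> {x0..x1} \<times> {y0..y1}"
    by (rule closure_minimal) (intro closed_Times closed_atLeastAtMost)
  moreover have "compact ({x0..x1} \<times> {y0..y1})" by (intro compact_Times compact_Icc)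
  moreover have "smooth_plane ?\<phi>"
    using assms(1,2) Ck_plane_product by (auto simp: smooth_plane_def smooth_real_def)
  ultimately show ?thesis
    unfolding test_function_def using assms(5) compact_closure bounded_subset compact_imp_bounded
    by (meson closed_closure closed_subset compact_eq_bounded_closed order_trans closure_subset)
qed

text \<open>Tested against \<open>a x * b y\<close>, where \<open>a\<close> and \<open>b\<close> smooth out the indicators of \<open>{0..X}\<close> and
  \<open>{- S..0}\<close>, the mixed derivative concentrates at the four corners of the rectangle.\<close>

lemma klein_gordon_integral_equation:
  assumes u: "continuous_on ({0..} \<times> {..0}) u"
    and kg: "klein_gordon_dist ({0<..} \<times> {..<0}) u"
    and XS: "X \<ge> 0" "S \<ge> 0"
  shows "u (0, 0) - u (0, - S) - u (X, 0) + u (X, - S) =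
    integral {0..X} (\<lambda>x. integral {0..S} (\<lambda>s. u (x, - s)))"
proof -
  obtain R \<rho> :: "real \<Rightarrow> real" where
    R: "\<And>x. (R has_real_derivative \<rho> x) (at x)" and sm: "smooth_real \<rho>" and nn: "\<And>x. 0 \<le> \<rho> x"
    and \<rho>0: "\<And>x. x \<le> 0 \<Longrightarrow> \<rho> x = 0" "\<And>x. 1 \<le> x \<Longrightarrow> \<rho> x = 0"
    and R0: "\<And>x. x \<le> 0 \<Longrightarrow> R x = 0" and R1: "\<And>x. 1 \<le> x \<Longrightarrow> R x = 1"
    using smooth_step_exists by blast
  have cont\<rho>: "continuous_on UNIV \<rho>"
    using sm Ck_real_continuous[of 0 \<rho>] by (simp add: smooth_real_def del: Ck_real.simps)
  have smR: "smooth_real R" using R sm by (rule smooth_real_antiderivative)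
  have mono: "R x \<le> R y" if "x \<le> y" for x y
    by (rule DERIV_nonneg_imp_nondecreasing[OF that]) (use R nn in blast)
  have R01: "0 \<le> R x" "R x \<le> 1" for x
    using mono[of "min 0 x" x] mono[of x "max 1 x"] R0[of "min 0 x"] R1[of "max 1 x"] by auto
  \<comment> \<open>A smoothed indicator: one step up behind 0 minus one step up behind
    \<open>L\<close>, each rising between distances \<open>1 / n\<close> and \<open>2 / n\<close>
    from its base point. Writing \<open>x - 0\<close> gives both terms the shape used in the kernel
    \<open>K\<close> below.\<close>
  define A where "A = (\<lambda>n L (x::real). R (real n * (x - 0) - 1) - R (real n * (x - L) - 1))"
  define A' where "A' = (\<lambda>n L (x::real). real n * \<rho> (real n * (x - 0) - 1) - real n * \<rho> (real n * (x - L) - 1))"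
  have lin: "((\<lambda>x. n * (x - L) - 1) has_real_derivative n) (at x)" for n L x :: real
    by (rule derivative_eq_intros refl)+ simp
  have dA: "(A n L has_real_derivative A' n L x) (at x)" for n L x
    unfolding A_def A'_def by (intro DERIV_diff DERIV_chain'[OF lin R, THEN DERIV_cong]) simp_all
  have smA: "Ck_real k (A n L)" for k n L
  proof -
    have "Ck_real k (\<lambda>x. R (n * x + (- 1)) + (- 1) * R (n * x + (- n * L - 1)))"
      using smR by (intro Ck_real_add Ck_real_mult Ck_real_const Ck_real_affine) (auto simp: smooth_real_def)
    then show ?thesis by (simp add: A_def algebra_simps)
  qed
  have smB: "Ck_real k (\<lambda>y. A n L (- y))" for k n L
    using Ck_real_affine[OF smA[of k n L], of "-1" 0] by simp
  have dB: "((\<lambda>y. A n L (- y)) has_real_derivative - A' n L (- y)) (at y)" for n L y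
    by (rule DERIV_chain'[OF _ dA, THEN DERIV_cong]) (rule derivative_eq_intros refl | simp)+
  have A_supp: "x \<in> {1 / real n..L + 2 / real n}" if "A n L x \<noteq> 0" "n > 0" "L \<ge> 0" for n L x
  proof (rule ccontr)
    assume "x \<notin> {1 / real n..L + 2 / real n}"
    then consider "x < 1 / real n" | "x > L + 2 / real n" by fastforce
    then show False
    proof cases
      case 1
      then have "real n * x \<le> 1" using that by (simp add: field_simps)
      moreover from this have "real n * (x - L) \<le> 1"
        using that by (simp add: right_diff_distrib add_increasing2 diff_le_eq)
      ultimately show False using that R0 by (simp add: A_def)
    next
      case 2
      then have "real n * (x - L) \<ge> 2" using that by (simp add: field_simps)
      moreover from this have "real n * x \<ge> 2"
        using that by (simp add: right_diff_distrib) (smt (verit) mult_nonneg_nonneg of_nat_0_le_iff)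
      ultimately show False using that R1 by (simp add: A_def)
    qed
  qed
  have A_abs: "\<bar>A n L x\<bar> \<le> 1" for n L x
    using R01[of "real n * (x - 0) - 1"] R01[of "real n * (x - L) - 1"] unfolding A_def by linarith
  \<comment> \<open>Because of the shift by 1, each step vanishes at its own base point for every
    \<open>n\<close>. The limit therefore omits 0 and, for \<open>L > 0\<close>, includes
    \<open>L\<close>.\<close>
  have A_lim: "(\<lambda>n. A n L x) \<longlonglongrightarrow> indicator {0<..L} x" if "L \<ge> 0" for L x
  proof -
    have step: "(\<lambda>n. R (real n * (x - c) - 1)) \<longlonglongrightarrow> (if x > c then 1 else 0)" for c
    proof (cases "x > c")
      case True
      then have "\<forall>\<^sub>F n in sequentially. real n * (x - c) - 1 \<ge> 1"
        by real_asymp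
      then have "\<forall>\<^sub>F n in sequentially. R (real n * (x - c) - 1) = 1"
        by eventually_elim (simp add: R1)
      then show ?thesis using True by (simp add: tendsto_eventually)
    next
      case False
      then have "R (real n * (x - c) - 1) = 0" for n
        by (intro R0) (smt (verit) mult_nonneg_nonpos of_nat_0_le_iff)
      then show ?thesis using False by simp
    qed
    show ?thesis unfolding A_def
      using tendsto_diff[OF step[of 0] step[of L]] that by (auto simp: indicator_def split: if_splits)
  qed
  define \<Omega> :: "(real \<times> real) set" where "\<Omega> = {0<..} \<times> {..<0}"
  define \<phi> where "\<phi> = (\<lambda>n z. A n X (fst z) * A n S (- snd z))"
  define K where "K = (\<lambda>p q n z. real n * \<rho> (real n * (fst z - p) - 1) * (real n * \<rho> (real n * (- snd z - q) - 1)))"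
  define C where "C = (\<lambda>n. {1 / real n..X + 2 / real n} \<times> {- (S + 2 / real n)..- (1 / real n)})"
  have C_cbox: "C n = cbox (1 / real n, - (S + 2 / real n)) (X + 2 / real n, - (1 / real n))" for n
    by (simp add: C_def cbox_Pair_eq)
  have C_sub: "C n \<subseteq> \<Omega>" if "n > 0" for n
  proof -
    have "{e..a} \<times> {b..- e} \<subseteq> {0<..} \<times> {..<0}" if "e > 0" for a b e :: real
      using that by auto
    then show ?thesis using that by (simp add: C_def \<Omega>_def)
  qed
  have contu: "continuous_on T u" if "T \<subseteq> {0..} \<times> {..0}" for T
    using u that by (rule continuous_on_subset)
  have \<Omega>_sub: "\<Omega> \<subseteq> {0..} \<times> {..0}" by (auto simp: \<Omega>_def)
  have contA: "continuous_on UNIV (A n L)" for n L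
    using smA[of 0 n L] by simp
  have cont\<phi>: "continuous_on T (\<lambda>z. \<phi> n z)" for n T
    unfolding \<phi>_def by (intro continuous_intros continuous_on_compose2[OF contA]) auto
  have \<phi>0: "\<phi> n z = 0" if "z \<notin> C n" "n > 0" for n z
  proof (rule ccontr)
    assume "\<phi> n z \<noteq> 0"
    then have "fst z \<in> {1 / real n..X + 2 / real n}" "- snd z \<in> {1 / real n..S + 2 / real n}"
      using A_supp that XS by (auto simp: \<phi>_def)
    then have "z \<in> C n" by (cases z) (auto simp: C_def)
    then show False using that by simp
  qed
  have "test_function \<Omega> (\<lambda>(x, y). of_real (A n X x * A n S (- y)))" if "n > 0" for n
  proof (rule test_function_product)
    show "smooth_real (A n X)" "smooth_real (\<lambda>y. A n S (- y))" using smA smB by (auto simp: smooth_real_def)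
    show "{1 / real n..X + 2 / real n} \<times> {- (S + 2 / real n)..- (1 / real n)} \<subseteq> \<Omega>"
      using C_sub[OF that] by (simp add: C_def)
    show "x \<in> {1 / real n..X + 2 / real n}" if "A n X x \<noteq> 0" for x
      using A_supp that \<open>n > 0\<close> XS by blast
    show "y \<in> {- (S + 2 / real n)..- (1 / real n)}" if "A n S (- y) \<noteq> 0" for y
      using A_supp[OF that \<open>n > 0\<close>] XS by auto
  qed
  then have "dist_of \<Omega> u (partial_y (partial_x (\<lambda>(x, y). of_real (A n X x * A n S (- y))))) +
      dist_of \<Omega> u (\<lambda>(x, y). of_real (A n X x * A n S (- y))) = 0" if "n > 0" for n
    using kg that unfolding klein_gordon_dist_def \<Omega>_def dist_partial_x_def dist_partial_y_def by simp
  moreover have "partial_y (partial_x (\<lambda>(x, y). of_real (A n X x * A n S (- y)))) =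
     (\<lambda>(x, y). of_real (A' n X x * - A' n S (- y)))" for n
    by (simp only: partial_x_product[OF dA] partial_y_product[OF dB])
  \<comment> \<open>The two signs of the distributional derivatives cancel, while the reflection in
    the second factor contributes one; moving that term across leaves no sign.\<close>
  ultimately have eq1: "(LINT z:\<Omega>|lborel. u z * of_real (A' n X (fst z) * A' n S (- snd z))) =
      (LINT z:\<Omega>|lborel. u z * of_real (\<phi> n z))" if "n > 0" for n
    using that by (simp add: dist_of_def case_prod_beta \<phi>_def set_lebesgue_integral_def)
  \<comment> \<open>Expanding the product of two differences gives one kernel per corner. Each of
    the four, and not only their signed sum, is supported in the box \<open>C n\<close>.\<close>
  have intK: "set_integrable lborel \<Omega> (\<lambda>z. u z * of_real (K p q n z))"
    if "n > 0" "p \<in> {0, X}" "q \<in> {0, S}" for p q n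
  proof (rule set_integrable_cbox_support)
    show "cbox (1 / real n, - (S + 2 / real n)) (X + 2 / real n, - (1 / real n)) \<subseteq> \<Omega>"
      using C_sub that by (simp add: C_cbox)
    then show "continuous_on (cbox (1 / real n, - (S + 2 / real n)) (X + 2 / real n, - (1 / real n))) (\<lambda>z. u z * of_real (K p q n z))"
      unfolding K_def using \<Omega>_sub by (intro continuous_intros contu continuous_on_compose2[OF cont\<rho>]) auto
    have \<rho>_supp: "\<rho> (real n * (x - c) - 1) = 0" if c: "x \<notin> {1 / real n..L + 2 / real n}" "c \<in> {0, L}" "L \<ge> 0" for x c L
    proof -
      consider "x < 1 / real n" | "x > L + 2 / real n" using c by fastforce
      then show ?thesis
      proof cases
        case 1
        then have "x - c \<le> 1 / real n" using c by auto
        then have "real n * (x - c) \<le> 1" using \<open>n > 0\<close> by (simp add: field_simps)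
        then show ?thesis using \<rho>0 by simp
      next
        case 2
        then have "x - c \<ge> 2 / real n" using c by auto
        then have "real n * (x - c) \<ge> 2" using \<open>n > 0\<close> by (simp add: field_simps)
        then show ?thesis using \<rho>0 by simp
      qed
    qed
    show "u z * of_real (K p q n z) = 0" if "z \<notin> cbox (1 / real n, - (S + 2 / real n)) (X + 2 / real n, - (1 / real n))" for z
    proof -
      have "fst z \<notin> {1 / real n..X + 2 / real n} \<or> - snd z \<notin> {1 / real n..S + 2 / real n}"
        using that by (cases z) (auto simp: cbox_Pair_eq)
      then show ?thesis using \<rho>_supp \<open>p \<in> {0, X}\<close> \<open>q \<in> {0, S}\<close> XS unfolding K_def by (auto simp del: insert_iff)
    qed
  qed
  have split: "(LINT z:\<Omega>|lborel. u z * of_real (A' n X (fst z) * A' n S (- snd z))) =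
     (LINT z:\<Omega>|lborel. u z * of_real (K 0 0 n z)) - (LINT z:\<Omega>|lborel. u z * of_real (K 0 S n z))
     - (LINT z:\<Omega>|lborel. u z * of_real (K X 0 n z)) + (LINT z:\<Omega>|lborel. u z * of_real (K X S n z))" if "n > 0" for n
  proof -
    have "(\<lambda>z. u z * of_real (A' n X (fst z) * A' n S (- snd z))) =
      (\<lambda>z. u z * of_real (K 0 0 n z) - u z * of_real (K 0 S n z) - u z * of_real (K X 0 n z) + u z * of_real (K X S n z))"
      by (simp add: A'_def K_def fun_eq_iff algebra_simps)
    then show ?thesis using intK[OF that] by (simp add: set_integral_add set_integral_diff)
  qed
  have moll: "(\<lambda>n. LINT z:\<Omega>|lborel. u z * of_real (K p q n z)) \<longlonglongrightarrow> u (p, - q)" if "p \<ge> 0" "q \<ge> 0" for p q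
    unfolding \<Omega>_def K_def
    by (rule mollifier_tendsto[where R = R]) (use u R cont\<rho> nn \<rho>0 R0 R1 that in auto)
  have "(\<lambda>n. (LINT z:\<Omega>|lborel. u z * of_real (K 0 0 n z)) - (LINT z:\<Omega>|lborel. u z * of_real (K 0 S n z))
     - (LINT z:\<Omega>|lborel. u z * of_real (K X 0 n z)) + (LINT z:\<Omega>|lborel. u z * of_real (K X S n z)))
     \<longlonglongrightarrow> u (0, - 0) - u (0, - S) - u (X, - 0) + u (X, - S)"
    using XS by (intro tendsto_intros moll) auto
  moreover have "\<forall>\<^sub>F n in sequentially. (LINT z:\<Omega>|lborel. u z * of_real (K 0 0 n z)) - (LINT z:\<Omega>|lborel. u z * of_real (K 0 S n z))
     - (LINT z:\<Omega>|lborel. u z * of_real (K X 0 n z)) + (LINT z:\<Omega>|lborel. u z * of_real (K X S n z)) =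
      (LINT z:\<Omega>|lborel. u z * of_real (\<phi> n z))"
    using eventually_gt_at_top[of 0] by eventually_elim (simp flip: eq1 split)
  ultimately have lim1: "(\<lambda>n. LINT z:\<Omega>|lborel. u z * of_real (\<phi> n z)) \<longlonglongrightarrow> u (0, 0) - u (0, - S) - u (X, 0) + u (X, - S)"
    using Lim_transform_eventually by force
  \<comment> \<open>The half-open edges are those left by \<open>A_lim\<close>; under
    \<open>y = - s\<close> the interval \<open>{0<..S}\<close> becomes
    \<open>{- S..<0}\<close>.\<close>
  define E where "E = {0<..X} \<times> {- S..<0}"
  have E_sub: "E \<subseteq> {0..} \<times> {..0}" by (auto simp: E_def)
  \<comment> \<open>Since \<open>2 / Suc n \<le> 2\<close>, this fixed box contains every
    \<open>C (Suc n)\<close>, so a bound of \<open>u\<close> on it gives an integrable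
    majorant.\<close>
  define D where "D = {0..X + 2} \<times> {- (S + 2)..0}"
  have D: "D = cbox (0, - (S + 2)) (X + 2, 0)" by (simp add: D_def cbox_Pair_eq)
  have "compact (u ` D)"
    by (rule compact_continuous_image[OF contu]) (auto simp: D_def intro: compact_Times)
  then obtain M where M: "\<And>z. z \<in> D \<Longrightarrow> cmod (u z) \<le> M"
    using compact_imp_bounded bounded_iff by (metis imageI)
  have "0 \<le> cmod (u (0, 0))" by simp
  also have "\<dots> \<le> M" using M[of "(0, 0)"] XS by (simp add: D_def)
  finally have M0: "0 \<le> M" .
  have Eb: "E \<in> sets borel"
  proof -
    have "E = ({0..X} \<times> {- S..0}) \<inter> \<Omega>" by (auto simp: E_def \<Omega>_def)
    moreover have "closed ({0..X} \<times> {- S..0})" by (intro closed_Times closed_atLeastAtMost)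
    moreover have "open \<Omega>" unfolding \<Omega>_def by (intro open_Times) auto
    ultimately show ?thesis by (simp add: borel_open borel_closed)
  qed
  have \<Omega>b: "\<Omega> \<in> sets borel" unfolding \<Omega>_def by (intro borel_open open_Times) auto
  have lim2: "(\<lambda>n. LINT z:\<Omega>|lborel. u z * of_real (\<phi> (Suc n) z)) \<longlonglongrightarrow> (LINT z:E|lborel. u z)"
    unfolding set_lebesgue_integral_def
  proof (rule integral_dominated_convergence[where w = "\<lambda>z. M * indicator D z"])
    show "(\<lambda>z. indicator E z *\<^sub>R u z) \<in> borel_measurable lborel"
      using borel_measurable_continuous_on_indicator[OF Eb contu[OF E_sub]] by simp
    show "(\<lambda>z. indicator \<Omega> z *\<^sub>R (u z * of_real (\<phi> (Suc n) z))) \<in> borel_measurable lborel" for n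
      using borel_measurable_continuous_on_indicator[OF \<Omega>b continuous_on_mult[OF contu[OF \<Omega>_sub] continuous_on_of_real[OF cont\<phi>]]]
      by simp
    show "integrable lborel (\<lambda>z. M * indicator D z)"
      unfolding D by (intro integrable_mult_right integrable_real_indicator emeasure_compact_finite[OF compact_cbox]) simp
    show "AE z in lborel. (\<lambda>n. indicator \<Omega> z *\<^sub>R (u z * of_real (\<phi> (Suc n) z))) \<longlonglongrightarrow> indicator E z *\<^sub>R u z"
    proof (intro AE_I2)
      fix z :: "real \<times> real"
      have "(\<lambda>n. \<phi> n z) \<longlonglongrightarrow> indicator {0<..X} (fst z) * indicator {0<..S} (- snd z)"
        unfolding \<phi>_def using XS by (intro tendsto_mult A_lim)
      then have "(\<lambda>n. \<phi> (Suc n) z) \<longlonglongrightarrow> indicator {0<..X} (fst z) * indicator {0<..S} (- snd z)"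
        by (rule LIMSEQ_Suc)
      then have "(\<lambda>n. indicator \<Omega> z *\<^sub>R (u z * of_real (\<phi> (Suc n) z))) \<longlonglongrightarrow>
          indicator \<Omega> z *\<^sub>R (u z * of_real (indicator {0<..X} (fst z) * indicator {0<..S} (- snd z)))"
        by (intro tendsto_intros)
      also have "indicator \<Omega> z *\<^sub>R (u z * of_real (indicator {0<..X} (fst z) * indicator {0<..S} (- snd z))) = indicator E z *\<^sub>R u z"
        by (cases z) (auto simp: indicator_def E_def \<Omega>_def)
      finally show "(\<lambda>n. indicator \<Omega> z *\<^sub>R (u z * of_real (\<phi> (Suc n) z))) \<longlonglongrightarrow> indicator E z *\<^sub>R u z" .
    qed
    show "AE z in lborel. cmod (indicator \<Omega> z *\<^sub>R (u z * of_real (\<phi> (Suc n) z))) \<le> M * indicator D z" for n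
    proof (intro AE_I2)
      fix z :: "real \<times> real"
      show "cmod (indicator \<Omega> z *\<^sub>R (u z * of_real (\<phi> (Suc n) z))) \<le> M * indicator D z"
      proof (cases "z \<in> C (Suc n)")
        case True
        have "{e..X + d} \<times> {- (S + d)..- e} \<subseteq> D" if "e > 0" "d \<le> 2" for e d
          using that by (auto simp: D_def)
        from this[of "1 / real (Suc n)" "2 / real (Suc n)"] have "z \<in> D"
          using True by (auto simp: C_def field_simps)
        have "\<bar>\<phi> (Suc n) z\<bar> \<le> 1 * 1"
          unfolding \<phi>_def abs_mult by (intro mult_mono A_abs) auto
        then have "cmod (u z) * \<bar>\<phi> (Suc n) z\<bar> \<le> M * 1"
          using M[OF \<open>z \<in> D\<close>] M0 by (intro mult_mono) auto
        then show ?thesis using \<open>z \<in> D\<close> M0 by (simp add: norm_mult indicator_def)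
      next
        case False
        then have "\<phi> (Suc n) z = 0" by (intro \<phi>0) auto
        then show ?thesis using M0 by simp
      qed
    qed
  qed
  have D0: "cbox (0, - S) (X, 0) = {0..X} \<times> {- S..0}" by (simp add: cbox_Pair_eq)
  have contD: "continuous_on (cbox (0, - S) (X, 0)) u" by (rule contu) (auto simp: D0)
  have "set_integrable lborel (cbox (0, - S) (X, 0)) u"
    unfolding set_integrable_def by (rule borel_integrable_compact[OF compact_cbox contD])
  then have "set_integrable lborel E u"
    by (rule set_integrable_subset) (use Eb in \<open>auto simp: E_def D0\<close>)
  then have "(LINT z:E|lborel. u z) = integral E u"
    by (rule set_borel_integral_eq_integral)
  also have "\<dots> = integral (cbox (0, - S) (X, 0)) u"
  proof (rule integral_spike_set)
    have "negligible (cbox (0, - S) (X, 0) - E)"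
      by (rule negligible_subset[OF negligible_frontier_interval[of "(0, - S)" "(X, 0)"]])
        (auto simp: E_def D0 box_prod)
    then show "negligible {z \<in> cbox (0, - S) (X, 0) - E. u z \<noteq> 0}"
      by (rule negligible_subset) auto
    have "{z \<in> E - cbox (0, - S) (X, 0). u z \<noteq> 0} = {}" by (auto simp: E_def D0)
    then show "negligible {z \<in> E - cbox (0, - S) (X, 0). u z \<noteq> 0}" by (metis negligible_empty)
  qed
  also have "\<dots> = integral {0..X} (\<lambda>x. integral {- S..- 0} (\<lambda>y. u (x, - (- y))))"
    using integral_prod_continuous[OF contD] by simp
  also have "\<dots> = integral {0..X} (\<lambda>x. integral {0..S} (\<lambda>s. u (x, - s)))"
    by (subst Henstock_Kurzweil_Integration.integral_reflect_real[where f = "\<lambda>s. u (_, - s)"]) (rule refl)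
  finally show ?thesis
    using LIMSEQ_unique[OF LIMSEQ_Suc[OF lim1] lim2] by simp
qed

section \<open>Injectivity of the Laplace transform\<close>

text \<open>The right-hand side is the integral over the whole half-line from \<open>a\<close>. It
  serves as a tail estimate and as a bound uniform in the truncation point.\<close>

lemma integral_exp_neg_le:
  fixes a b d :: real
  assumes "d > 0" "a \<le> b"
  shows "integral {a..b} (\<lambda>x. exp (- (d * x))) \<le> exp (- (d * a)) / d"
proof -
  have "((\<lambda>x. exp (- (d * x))) has_integral (- exp (- (d * b)) / d) - (- exp (- (d * a)) / d)) {a..b}"
    by (rule fundamental_theorem_of_calculus[where f = "\<lambda>x. - exp (- (d * x)) / d"])
      (use assms in \<open>auto intro!: derivative_eq_intros simp: has_real_derivative_iff_has_vector_derivative[symmetric]\<close>)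
  then show ?thesis using assms by (simp add: integral_unique field_simps)
qed

text \<open>In the variable \<open>t = exp (- x)\<close> the transforms at \<open>l\<close>, \<open>l + 1\<close>, ... are moments, so the
  Weierstrass theorem allows testing against \<open>g\<close> itself.\<close>

lemma real_laplace_zero:
  fixes g :: "real \<Rightarrow> real"
  assumes cont: "continuous_on {0..} g"
    and bound: "\<And>x. x \<ge> 0 \<Longrightarrow> \<bar>g x\<bar> \<le> C * exp (\<alpha> * x)"
    and zero: "\<And>l. l > \<alpha> \<Longrightarrow> (\<lambda>N. integral {0..real N} (\<lambda>x. exp (- (l * x)) * g x)) \<longlonglongrightarrow> 0"
    and "x \<ge> 0"
  shows "g x = 0"
proof -
  have C: "C \<ge> 0" using bound[of 0] by simp
  \<comment> \<open>The power exceeds the growth rate by at least one, so that \<open>h\<close>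
    below is bounded by \<open>C * t\<close> and hence continuous at 0.\<close>
  obtain m :: nat where m: "real m \<ge> \<alpha> + 1" using real_arch_simple by blast
  define l where "l = \<alpha> + 1"
  define h where "h = (\<lambda>t. if t \<le> 0 then 0 else t ^ m * g (- ln t))"
  have contg: "continuous_on {0..b} g" for b
    using cont by (rule continuous_on_subset) auto
  have h_bound: "\<bar>h t\<bar> \<le> C * t" if "0 \<le> t" "t \<le> 1" for t
  proof (cases "t = 0")
    case False
    then have t: "t > 0" using that by simp
    have "\<bar>h t\<bar> \<le> t ^ m * (C * exp (\<alpha> * (- ln t)))"
      using t that bound[of "- ln t"] by (auto simp: h_def abs_mult intro!: mult_left_mono)
    also have "t ^ m = exp (real m * ln t)"
      using t by (simp add: exp_of_nat_mult)
    also have "exp (real m * ln t) * (C * exp (\<alpha> * (- ln t))) = C * exp ((real m - \<alpha>) * ln t)"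
      by (simp add: exp_add[symmetric] algebra_simps)
    also have "\<dots> \<le> C * exp (1 * ln t)"
      using t that m C by (intro mult_left_mono exp_le_cancel_iff[THEN iffD2] mult_right_mono_neg) auto
    finally show ?thesis using t by simp
  qed (simp add: h_def)
  have "continuous_on {0..1} h"
    unfolding continuous_on_eq_continuous_within
  proof
    fix t :: real assume t: "t \<in> {0..1}"
    show "continuous (at t within {0..1}) h"
    proof (cases "t = 0")
      case True
      have "((\<lambda>t. C * t) \<longlongrightarrow> C * 0) (at 0 within {0..1})"
        by (intro tendsto_intros)
      then have "((\<lambda>t. C * t) \<longlongrightarrow> 0) (at 0 within {0..1})" by simp
      moreover have "\<forall>\<^sub>F t in at 0 within {0..1}. norm (h t) \<le> C * t"
        using h_bound by (auto simp: eventually_at_filter)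
      ultimately have "(h \<longlongrightarrow> 0) (at 0 within {0..1})"
        by (rule Lim_null_comparison[rotated])
      then show ?thesis using True by (simp add: continuous_within h_def)
    next
      case False
      have "continuous_on {0<..1} (\<lambda>t. t ^ m * g (- ln t))"
        by (intro continuous_intros continuous_on_compose2[OF cont]) auto
      then have "continuous_on {0<..1} h"
        by (rule continuous_on_eq) (auto simp: h_def)
      then have "continuous (at t within {0<..1}) h"
        using t False by (auto simp: continuous_on_eq_continuous_within)
      moreover have "at t within {0..1} = at t within {0<..1}"
        by (rule at_within_nhd[of _ "{0<..}"]) (use t False in auto)
      ultimately show ?thesis by simp
    qed
  qed
  note conth = this
  have hexp: "h (exp (- x)) = exp (- (real m * x)) * g x" for x
    by (simp add: h_def exp_of_nat_mult[symmetric])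
  \<comment> \<open>By \<open>hexp\<close> the integrand is \<open>exp (- ((l + m) * x))\<close>
    times the square of \<open>g x\<close>. It is nonnegative, so \<open>g\<close> vanishes as soon
    as \<open>J\<close> does.\<close>
  define J where "J = (\<lambda>N. integral {0..N} (\<lambda>x. exp (- (l * x)) * (g x * h (exp (- x)))))"
  have conth': "continuous_on {0..b} (\<lambda>x. h (exp (- x)))" for b
    unfolding hexp by (intro continuous_intros contg)
  have nonneg: "0 \<le> exp (- (l * y)) * (g y * h (exp (- y)))" for y
    by (simp add: hexp mult.left_commute[of "g y"])
  have J_le: "J N0 \<le> \<epsilon> * C" if "\<epsilon> > 0" "N0 \<ge> 0" for \<epsilon> N0
  proof -
    obtain p where p: "real_polynomial_function p" "\<And>t. t \<in> {0..1} \<Longrightarrow> \<bar>h t - p t\<bar> < \<epsilon>"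
      using Stone_Weierstrass_real_polynomial_function[OF _ conth \<open>\<epsilon> > 0\<close>] by auto
    then obtain a n where p_eq: "p = (\<lambda>x. \<Sum>i\<le>n. a i * x ^ i)"
      by (auto simp: real_polynomial_function_iff_sum)
    \<comment> \<open>With a polynomial in \<open>exp (- x)\<close> in place of \<open>h\<close>, a
      monomial of degree \<open>i\<close> merely shifts \<open>l\<close> to \<open>l + i\<close>,
      where the transform also tends to 0.\<close>
    define K where "K = (\<lambda>N. integral {0..N} (\<lambda>x. exp (- (l * x)) * (g x * p (exp (- x)))))"
    have contp: "continuous_on {0..b} (\<lambda>x. p (exp (- x)))" for b
      unfolding p_eq by (intro continuous_intros)
    have "K N = (\<Sum>i\<le>n. a i * integral {0..N} (\<lambda>x. exp (- ((l + real i) * x)) * g x))" for N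
    proof -
      have "K N = integral {0..N} (\<lambda>x. \<Sum>i\<le>n. a i * (exp (- ((l + real i) * x)) * g x))"
        unfolding K_def p_eq
        by (intro Henstock_Kurzweil_Integration.integral_cong)
          (auto simp: sum_distrib_left exp_of_nat_mult[symmetric] exp_add[symmetric] algebra_simps
            intro!: sum.cong simp flip: exp_add)
      also have "\<dots> = (\<Sum>i\<le>n. integral {0..N} (\<lambda>x. a i * (exp (- ((l + real i) * x)) * g x)))"
        by (intro Henstock_Kurzweil_Integration.integral_sum integrable_continuous_real continuous_intros contg) auto
      finally show ?thesis by simp
    qed
    then have "(\<lambda>N. K (real N)) = (\<lambda>N. \<Sum>i\<le>n. a i * integral {0..real N} (\<lambda>x. exp (- ((l + real i) * x)) * g x))"
      by simp
    also have "\<dots> \<longlonglongrightarrow> (\<Sum>i\<le>n. a i * 0)"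
      by (intro tendsto_intros zero) (simp add: l_def)
    finally have K0: "(\<lambda>N. K (real N)) \<longlonglongrightarrow> 0" by simp
    \<comment> \<open>For \<open>l = \<alpha> + 1\<close> the weight times
      \<open>\<bar>g x\<bar>\<close> is at most \<open>C * exp (- x)\<close>, whose integral never
      exceeds \<open>C\<close>; the approximation error is thus uniform in \<open>N\<close>.\<close>
    have JK: "J N - K N \<le> \<epsilon> * C" if "N \<ge> 0" for N
    proof -
      have "J N - K N = integral {0..N} (\<lambda>x. exp (- (l * x)) * (g x * h (exp (- x))) - exp (- (l * x)) * (g x * p (exp (- x))))"
        unfolding J_def K_def
        by (intro Henstock_Kurzweil_Integration.integral_diff[symmetric] integrable_continuous_real continuous_intros contg conth' contp)
      also have "\<dots> \<le> integral {0..N} (\<lambda>x. \<epsilon> * C * exp (- (1 * x)))"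
      proof (rule integral_le)
        fix x assume x: "x \<in> {0..N}"
        have "exp (- (l * x)) * (g x * h (exp (- x))) - exp (- (l * x)) * (g x * p (exp (- x)))
            = exp (- (l * x)) * (g x * (h (exp (- x)) - p (exp (- x))))"
          by (simp add: algebra_simps)
        also have "\<dots> \<le> exp (- (l * x)) * (\<bar>g x\<bar> * \<bar>h (exp (- x)) - p (exp (- x))\<bar>)"
          by (intro mult_left_mono) (auto simp flip: abs_mult)
        also have "\<dots> \<le> exp (- (l * x)) * ((C * exp (\<alpha> * x)) * \<epsilon>)"
          using x p(2)[of "exp (- x)"] bound[of x] C by (intro mult_left_mono mult_mono) auto
        also have "\<dots> = \<epsilon> * C * exp (- (1 * x))"
          by (simp add: l_def algebra_simps flip: exp_add)
        finally show "exp (- (l * x)) * (g x * h (exp (- x))) - exp (- (l * x)) * (g x * p (exp (- x)))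
            \<le> \<epsilon> * C * exp (- (1 * x))" .
      qed (auto intro!: integrable_continuous_real continuous_intros contg conth' contp)
      also have "\<dots> = \<epsilon> * C * integral {0..N} (\<lambda>x. exp (- (1 * x)))" by simp
      also have "\<dots> \<le> \<epsilon> * C * (exp (- (1 * 0)) / 1)"
        using that C \<open>\<epsilon> > 0\<close> by (intro mult_left_mono integral_exp_neg_le) auto
      finally show ?thesis by simp
    qed
    \<comment> \<open>Nonnegativity makes \<open>J\<close> increasing, so the bound obtained for
      large \<open>N\<close> carries over to the fixed \<open>N0\<close>.\<close>
    have "J N0 \<le> J (real N)" if "real N \<ge> N0" for N
      unfolding J_def
      by (rule integral_subset_le) (use that nonneg in \<open>auto intro!: integrable_continuous_real continuous_intros contg conth'\<close>)
    then have "J N0 - \<epsilon> * C \<le> K (real N)" if "real N \<ge> N0" for N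
      using JK[of "real N"] that \<open>N0 \<ge> 0\<close> by force
    moreover obtain M :: nat where "real M \<ge> N0" using real_arch_simple by blast
    ultimately have "J N0 - \<epsilon> * C \<le> 0"
      by (intro LIMSEQ_le_const[OF K0] exI[of _ M]) auto
    then show ?thesis by simp
  qed
  \<comment> \<open>Going beyond \<open>x\<close> keeps the interval nondegenerate when
    \<open>x = 0\<close>.\<close>
  have "continuous_on {0..x+1} (\<lambda>x. exp (- (l * x)) * (g x * h (exp (- x))))"
    by (intro continuous_intros contg conth')
  moreover have "J (x + 1) \<le> 0"
  proof (rule field_le_epsilon)
    fix e :: real assume e: "e > 0"
    \<comment> \<open>The denominator \<open>C + 1\<close> allows for \<open>C = 0\<close>.\<close>
    have "J (x + 1) \<le> e / (C + 1) * C" using e C \<open>x \<ge> 0\<close> by (intro J_le) auto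
    also have "\<dots> \<le> 0 + e" using e C by (simp add: field_simps)
    finally show "J (x + 1) \<le> 0 + e" .
  qed
  moreover have "J (x + 1) \<ge> 0" unfolding J_def
    by (intro integral_nonneg integrable_continuous_real continuous_intros contg conth' nonneg)
  ultimately have "J (x + 1) = 0" by simp
  then have "\<forall>y\<in>{0..x+1}. exp (- (l * y)) * (g y * h (exp (- y))) = 0"
    unfolding J_def
    by (subst (asm) integral_eq_0_iff)
      (use \<open>x \<ge> 0\<close> nonneg in \<open>auto intro!: continuous_intros contg conth'\<close>)
  then have "exp (- (l * x)) * (g x * h (exp (- x))) = 0" using \<open>x \<ge> 0\<close> by auto
  then show ?thesis by (simp add: hexp)
qed

text \<open>The truncated transforms are holomorphic and converge locally uniformly on
  \<open>Re z > \<alpha>\<close>, so the identity theorem extends the vanishing from an interval to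
  this half-plane. Real and imaginary parts then fall under
  \<open>real_laplace_zero\<close>.\<close>

lemma laplace_zero:
  fixes f :: "real \<Rightarrow> complex"
  assumes cont: "continuous_on {0..} f"
    and bound: "\<And>x. x \<ge> 0 \<Longrightarrow> cmod (f x) \<le> C * exp (\<alpha> * x)"
    and ab: "\<alpha> \<le> a" "a < b"
    and zero: "\<And>l. a < l \<Longrightarrow> l < b \<Longrightarrow>
      (\<lambda>N. integral {0..real N} (\<lambda>x. exp (- (l * x)) *\<^sub>R f x)) \<longlonglongrightarrow> 0"
    and "x \<ge> 0"
  shows "f x = 0"
proof -
  have C: "C \<ge> 0" using bound[of 0] by simp (meson norm_ge_zero order_trans)
  have contf: "continuous_on {b..c} f" if "b \<ge> 0" for b c
    using cont by (rule continuous_on_subset) (use that in auto)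
  define F where "F = (\<lambda>N z. integral {0..real N} (\<lambda>x. exp (- (z * of_real x)) * f x))"
  define H where "H = {z. Re z > \<alpha>}"
  have H: "open H" "connected H" "convex H"
    unfolding H_def by (auto simp: open_halfspace_Re_gt convex_halfspace_Re_gt intro: convex_connected)
  have int: "(\<lambda>x. exp (- (z * of_real x)) * f x) integrable_on {b..c}" if "b \<ge> 0" for z b c
    by (intro integrable_continuous_real continuous_intros contf that)
  have hol: "F N holomorphic_on H" for N
    unfolding F_def cbox_interval[symmetric]
  proof (rule leibniz_rule_holomorphic)
    show "((\<lambda>z. exp (- (z * of_real t)) * f t) has_field_derivative - of_real t * exp (- (z * of_real t)) * f t) (at z within H)"
      for z t by (auto intro!: derivative_eq_intros)
    show "(\<lambda>t. exp (- (z * of_real t)) * f t) integrable_on cbox 0 (real N)" for z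
      using int[of 0] by simp
    show "continuous_on (H \<times> cbox 0 (real N)) (\<lambda>(z, t). - of_real t * exp (- (z * of_real t)) * f t)"
      unfolding case_prod_beta
      by (intro continuous_intros continuous_on_compose2[OF cont]) auto
  qed (rule H)
  \<comment> \<open>The tail bound depends on \<open>z\<close> only through \<open>d\<close>, so it
    gives convergence at each point and uniform convergence on balls.\<close>
  have diff: "cmod (F M z - F N z) \<le> C * exp (- (d * real N)) / d" if "Re z \<ge> \<alpha> + d" "d > 0" "N \<le> M" for z d M N
  proof -
    have "F N z + integral {real N..real M} (\<lambda>x. exp (- (z * of_real x)) * f x) = F M z"
      unfolding F_def using that
      by (intro Henstock_Kurzweil_Integration.integral_combine int) auto
    then have "cmod (F M z - F N z) = cmod (integral {real N..real M} (\<lambda>x. exp (- (z * of_real x)) * f x))"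
      by (simp add: algebra_simps flip: \<open>_ = F M z\<close>)
    also have "\<dots> \<le> integral {real N..real M} (\<lambda>x. C * exp (- (d * x)))"
    proof (rule integral_norm_bound_integral)
      fix x assume x: "x \<in> {real N..real M}"
      then have x0: "x \<ge> 0" by (meson atLeastAtMost_iff of_nat_0_le_iff order_trans)
      have "cmod (exp (- (z * of_real x)) * f x) = exp (- (Re z * x)) * cmod (f x)"
        by (simp add: norm_mult)
      also have "\<dots> \<le> exp (- ((\<alpha> + d) * x)) * (C * exp (\<alpha> * x))"
        using x0 that bound[of x] by (intro mult_mono) (auto intro!: mult_right_mono)
      also have "\<dots> = C * exp (- (d * x))" by (simp add: algebra_simps flip: exp_add)
      finally show "cmod (exp (- (z * of_real x)) * f x) \<le> C * exp (- (d * x))" .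
    qed (intro int integrable_continuous_real continuous_intros; simp)+
    also have "\<dots> = C * integral {real N..real M} (\<lambda>x. exp (- (d * x)))" by simp
    also have "\<dots> \<le> C * (exp (- (d * real N)) / d)"
      using that C by (intro mult_left_mono integral_exp_neg_le) auto
    finally show ?thesis by simp
  qed
  have err0: "(\<lambda>N. C * exp (- (d * real N)) / d) \<longlonglongrightarrow> 0" if "d > 0" for d
    using that by real_asymp
  define G where "G = (\<lambda>z. lim (\<lambda>N. F N z))"
  have lim: "(\<lambda>N. F N z) \<longlonglongrightarrow> G z" if "z \<in> H" for z
  proof -
    define d where "d = Re z - \<alpha>"
    have d: "d > 0" using that by (simp add: d_def H_def)
    have "Cauchy (\<lambda>N. F N z)"
    proof (rule metric_CauchyI)
      fix e :: real assume "e > 0"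
      then obtain N where N: "\<And>n. n \<ge> N \<Longrightarrow> C * exp (- (d * real n)) / d < e"
        using order_tendstoD(2)[OF err0[OF d]] by (auto simp: eventually_sequentially)
      have "dist (F m z) (F n z) < e" if "m \<ge> N" "n \<ge> N" for m n
        using that diff[of d z m n] diff[of d z n m] d N[of m] N[of n]
        by (cases "n \<le> m") (auto simp: dist_norm norm_minus_commute d_def)
      then show "\<exists>M. \<forall>m\<ge>M. \<forall>n\<ge>M. dist (F m z) (F n z) < e" by blast
    qed
    then show ?thesis unfolding G_def
      by (simp add: Cauchy_convergent_iff convergent_LIMSEQ_iff)
  qed
  have "G holomorphic_on H"
  proof (rule holomorphic_uniform_sequence[OF H(1) hol])
    fix z assume "z \<in> H"
    \<comment> \<open>Half the distance to the boundary line: the ball of radius \<open>d\<close>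
      stays in \<open>Re w \<ge> \<alpha> + d\<close>, so one bound serves all its points.\<close>
    define d where "d = (Re z - \<alpha>) / 2"
    have d: "d > 0" using \<open>z \<in> H\<close> by (simp add: d_def H_def)
    have re: "Re w \<ge> \<alpha> + d" if "w \<in> cball z d" for w
      using that abs_Re_le_cmod[of "z - w"] by (simp add: dist_norm d_def field_simps)
    then have sub: "cball z d \<subseteq> H" using d by (force simp: H_def)
    have "uniform_limit (cball z d) F G sequentially"
    proof (rule uniform_limitI)
      fix e :: real assume "e > 0"
      have "\<forall>\<^sub>F n in sequentially. C * exp (- (d * real n)) / d < e"
        using order_tendstoD(2)[OF err0[OF d] \<open>e > 0\<close>] .
      then show "\<forall>\<^sub>F n in sequentially. \<forall>w\<in>cball z d. dist (F n w) (G w) < e"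
      proof (rule eventually_mono, intro ballI)
        fix n w assume n: "C * exp (- (d * real n)) / d < e" and w: "w \<in> cball z d"
        have "(\<lambda>M. F M w - F n w) \<longlonglongrightarrow> G w - F n w"
          using lim w sub by (intro tendsto_intros) auto
        then have "cmod (G w - F n w) \<le> C * exp (- (d * real n)) / d"
          by (rule Lim_norm_ubound[rotated])
            (auto simp: eventually_sequentially intro!: exI[of _ n] diff re w d)
        then show "dist (F n w) (G w) < e" using n by (simp add: dist_norm norm_minus_commute)
      qed
    qed
    then show "\<exists>d>0. cball z d \<subseteq> H \<and> uniform_limit (cball z d) F G sequentially"
      using d sub by blast
  qed
  have F_real: "F N (of_real l) = integral {0..real N} (\<lambda>x. exp (- (l * x)) *\<^sub>R f x)" for N l
    unfolding F_def by (simp add: scaleR_conv_of_real exp_of_real[symmetric])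
  have G0: "G (of_real l) = 0" if "a < l" "l < b" for l
    using zero[OF that] lim[of "of_real l"] that ab LIMSEQ_unique by (force simp: F_real H_def)
  have "G z = 0" if "z \<in> H" for z
  proof (rule analytic_continuation[OF \<open>G holomorphic_on H\<close> H(1,2)])
    show "of_real ` {a<..<b} \<subseteq> H" "of_real ((a + b) / 2) \<in> H"
      using ab by (auto simp: H_def)
    show "complex_of_real ((a + b) / 2) islimpt of_real ` {a<..<b}"
      unfolding islimpt_approachable
    proof (intro allI impI)
      fix e :: real assume e: "e > 0"
      \<comment> \<open>The positive offset from the midpoint is below \<open>e\<close> and too
        small to leave the interval.\<close>
      define s where "s = (a + b) / 2 + min (e / 2) ((b - a) / 4)"
      have "s \<in> {a<..<b}" "s \<noteq> (a + b) / 2" "\<bar>s - (a + b) / 2\<bar> < e"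
        using e ab by (auto simp: s_def min_def field_simps)
      then show "\<exists>x'\<in>complex_of_real ` {a<..<b}. x' \<noteq> of_real ((a + b) / 2) \<and> dist x' (of_real ((a + b) / 2)) < e"
        by (intro bexI[of _ "of_real s"]) (auto simp: dist_norm simp flip: of_real_diff simp del: of_real_divide of_real_add)
    qed
  qed (use G0 that in auto)
  then have lim0: "(\<lambda>N. integral {0..real N} (\<lambda>x. exp (- (l * x)) *\<^sub>R f x)) \<longlonglongrightarrow> 0" if "l > \<alpha>" for l
    using lim[of "of_real l"] that by (simp add: F_real H_def)
  have fint: "(\<lambda>x. exp (- (l * x)) *\<^sub>R f x) integrable_on {0..real N}" for l N
    by (intro integrable_continuous_real continuous_intros contf) simp
  have part: "T (f x) = 0" if T: "bounded_linear T" "\<And>z. \<bar>T z\<bar> \<le> cmod z" for T :: "complex \<Rightarrow> real"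
  proof (rule real_laplace_zero[of "\<lambda>x. T (f x)" C \<alpha>])
    show "continuous_on {0..} (\<lambda>x. T (f x))"
      using bounded_linear.continuous_on[OF T(1) cont] .
    show "\<bar>T (f x)\<bar> \<le> C * exp (\<alpha> * x)" if "x \<ge> 0" for x
      using T(2)[of "f x"] bound[OF that] by simp
    show "(\<lambda>N. integral {0..real N} (\<lambda>x. exp (- (l * x)) * T (f x))) \<longlonglongrightarrow> 0" if "l > \<alpha>" for l
      using bounded_linear.tendsto[OF T(1) lim0[OF that]]
        integral_linear[OF fint T(1), of _ l] bounded_linear.linear[OF T(1)]
      by (simp add: o_def linear_cmul linear_0)
  qed fact
  show ?thesis
    using part[OF bounded_linear_Re] part[OF bounded_linear_Im] abs_Re_le_cmod abs_Im_le_cmod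
    by (simp add: complex_eq_iff)
qed

section \<open>The Goursat problem\<close>

lemma integral_exp_le:
  fixes a b :: real
  assumes "b > 0" "0 \<le> a"
  shows "integral {0..a} (\<lambda>x. exp (b * x)) \<le> exp (b * a) / b"
proof -
  have "((\<lambda>x. exp (b * x)) has_integral exp (b * a) / b - exp (b * 0) / b) {0..a}"
    by (rule fundamental_theorem_of_calculus[where f = "\<lambda>x. exp (b * x) / b"])
      (use assms in \<open>auto intro!: derivative_eq_intros simp: has_real_derivative_iff_has_vector_derivative[symmetric]\<close>)
  then show ?thesis using assms by (simp add: integral_unique field_simps)
qed

lemma continuous_on_section:
  assumes "continuous_on (A \<times> B) (\<lambda>(x, s). v x s)"
  shows "x \<in> A \<Longrightarrow> continuous_on B (\<lambda>s. v x s)" "s \<in> B \<Longrightarrow> continuous_on A (\<lambda>x. v x s)"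
proof -
  have "continuous_on B (\<lambda>s. (\<lambda>(x, s). v x s) (x, s))" if "x \<in> A"
    by (rule continuous_on_compose2[OF assms]) (use that in \<open>auto intro!: continuous_intros\<close>)
  then show "x \<in> A \<Longrightarrow> continuous_on B (\<lambda>s. v x s)" by simp
  have "continuous_on A (\<lambda>x. (\<lambda>(x, s). v x s) (x, s))" if "s \<in> B"
    by (rule continuous_on_compose2[OF assms]) (use that in \<open>auto intro!: continuous_intros\<close>)
  then show "s \<in> B \<Longrightarrow> continuous_on A (\<lambda>x. v x s)" by simp
qed

text \<open>The constant does not depend on the point because the integral operator is a contraction with
  factor \<open>1 / (\<alpha> * \<beta>)\<close> for the weighted supremum norm on every rectangle.\<close>

lemma goursat_growth:
  fixes v :: "real \<Rightarrow> real \<Rightarrow> complex"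
  assumes cont: "continuous_on ({0..} \<times> {0..}) (\<lambda>(x, s). v x s)"
    and eq: "\<And>x s. x \<ge> 0 \<Longrightarrow> s \<ge> 0 \<Longrightarrow> v x s = v x 0 + integral {0..x} (\<lambda>t. integral {0..s} (v t))"
    and bound: "\<And>x. x \<ge> 0 \<Longrightarrow> cmod (v x 0) \<le> C * exp (\<alpha> * x)"
    and pos: "\<alpha> > 0" "\<beta> > 0" "\<alpha> * \<beta> > 1"
    and xs: "x \<ge> 0" "s \<ge> 0"
  shows "cmod (v x s) \<le> C / (1 - 1 / (\<alpha> * \<beta>)) * exp (\<alpha> * x + \<beta> * s)"
proof -
  \<comment> \<open>The weighted modulus is maximised over a compact rectangle, so no global bound
    on \<open>v\<close> is presupposed.\<close>
  define g where "g = (\<lambda>z. cmod (v (fst z) (snd z)) * exp (- (\<alpha> * fst z + \<beta> * snd z)))"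
  have "continuous_on ({0..x} \<times> {0..s}) (\<lambda>(x, s). v x s)"
    by (rule continuous_on_subset[OF cont]) auto
  then have "continuous_on ({0..x} \<times> {0..s}) g"
    unfolding g_def case_prod_beta by (intro continuous_intros)
  moreover have "compact ({0..x} \<times> {0..s})" by (intro compact_Times compact_Icc)
  moreover have "(0, 0) \<in> {0..x} \<times> {0..s}" using xs by simp
  ultimately obtain z where z: "z \<in> {0..x} \<times> {0..s}" "\<And>w. w \<in> {0..x} \<times> {0..s} \<Longrightarrow> g w \<le> g z"
    using continuous_attains_sup[of "{0..x} \<times> {0..s}" g] by blast
  obtain x0 s0 where z_eq: "z = (x0, s0)" by force
  then have x0: "0 \<le> x0" "x0 \<le> x" "0 \<le> s0" "s0 \<le> s" using z by auto
  define M where "M = g z"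
  have M: "cmod (v t r) \<le> M * exp (\<alpha> * t + \<beta> * r)" if "0 \<le> t" "t \<le> x" "0 \<le> r" "r \<le> s" for t r
  proof -
    have "cmod (v t r) = g (t, r) * exp (\<alpha> * t + \<beta> * r)"
      by (simp add: g_def mult.assoc flip: exp_add)
    also have "\<dots> \<le> M * exp (\<alpha> * t + \<beta> * r)"
      using z(2)[of "(t, r)"] that unfolding M_def by (intro mult_right_mono) auto
    finally show ?thesis .
  qed
  have M0: "M \<ge> 0" by (simp add: M_def g_def)
  have cont_r: "continuous_on {0..s0} (v t)" if "t \<ge> 0" for t
    using continuous_on_section(1)[OF cont, of t] that by (auto intro: continuous_on_subset)
  have contP: "continuous_on {0..x0} (\<lambda>t. integral {0..s0} (v t))"
    unfolding cbox_interval[symmetric]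
    by (rule integral_continuous_on_param, rule continuous_on_subset[OF cont]) auto
  have inner: "cmod (integral {0..s0} (v t)) \<le> M * (exp (\<beta> * s0) / \<beta>) * exp (\<alpha> * t)" if "0 \<le> t" "t \<le> x0" for t
  proof -
    have "cmod (integral {0..s0} (v t)) \<le> integral {0..s0} (\<lambda>r. M * exp (\<alpha> * t) * exp (\<beta> * r))"
      using that x0 M[of t]
      by (intro integral_norm_bound_integral integrable_continuous_real continuous_intros cont_r) (auto simp: exp_add mult.assoc)
    also have "\<dots> = M * exp (\<alpha> * t) * integral {0..s0} (\<lambda>r. exp (\<beta> * r))" by simp
    also have "\<dots> \<le> M * exp (\<alpha> * t) * (exp (\<beta> * s0) / \<beta>)"
      using M0 pos x0 by (intro mult_left_mono integral_exp_le) auto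
    finally show ?thesis by (simp add: mult_ac)
  qed
  have "cmod (integral {0..x0} (\<lambda>t. integral {0..s0} (v t))) \<le> integral {0..x0} (\<lambda>t. M * (exp (\<beta> * s0) / \<beta>) * exp (\<alpha> * t))"
    using inner by (intro integral_norm_bound_integral integrable_continuous_real continuous_intros contP) auto
  also have "\<dots> = M * (exp (\<beta> * s0) / \<beta>) * integral {0..x0} (\<lambda>t. exp (\<alpha> * t))" by simp
  also have "\<dots> \<le> M * (exp (\<beta> * s0) / \<beta>) * (exp (\<alpha> * x0) / \<alpha>)"
    using M0 pos x0 by (intro mult_left_mono integral_exp_le) auto
  also have "\<dots> = M / (\<alpha> * \<beta>) * exp (\<alpha> * x0 + \<beta> * s0)" by (simp add: exp_add field_simps)
  finally have I: "cmod (integral {0..x0} (\<lambda>t. integral {0..s0} (v t))) \<le> M / (\<alpha> * \<beta>) * exp (\<alpha> * x0 + \<beta> * s0)" .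
  have "0 \<le> cmod (v 0 0)" by simp
  also have "\<dots> \<le> C" using bound[of 0] by simp
  finally have C: "C \<ge> 0" .
  \<comment> \<open>At the maximum point the integral equation gives
    \<open>M \<le> C + M / (\<alpha> * \<beta>)\<close>; since \<alpha> * \<beta> > 1, the last term
    can be absorbed on the left.\<close>
  have "M * exp (\<alpha> * x0 + \<beta> * s0) = cmod (v x0 s0)"
    by (simp add: M_def g_def z_eq mult.assoc flip: exp_add)
  also have "\<dots> \<le> cmod (v x0 0) + cmod (integral {0..x0} (\<lambda>t. integral {0..s0} (v t)))"
    using eq[of x0 s0] x0 norm_triangle_ineq by metis
  also have "\<dots> \<le> C * exp (\<alpha> * x0) + M / (\<alpha> * \<beta>) * exp (\<alpha> * x0 + \<beta> * s0)"
    using bound[of x0] x0 I by (intro add_mono) auto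
  also have "\<dots> \<le> C * exp (\<alpha> * x0 + \<beta> * s0) + M / (\<alpha> * \<beta>) * exp (\<alpha> * x0 + \<beta> * s0)"
    using C x0 pos by (intro add_right_mono mult_left_mono) auto
  also have "\<dots> = (C + M / (\<alpha> * \<beta>)) * exp (\<alpha> * x0 + \<beta> * s0)" by (simp add: algebra_simps)
  finally have "M \<le> C + M / (\<alpha> * \<beta>)" by simp
  then have "M * (1 - 1 / (\<alpha> * \<beta>)) \<le> C" by (simp add: algebra_simps)
  moreover have "1 - 1 / (\<alpha> * \<beta>) > 0" using pos by simp
  ultimately have "M \<le> C / (1 - 1 / (\<alpha> * \<beta>))" by (simp add: pos_le_divide_eq)
  then show ?thesis using M[of x s] xs
    by (meson exp_ge_zero mult_right_mono order_refl order_trans)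
qed

text \<open>The full Laplace transform would satisfy \<open>l * V'(s) = V(s)\<close> exactly; the error comes from the
  truncation at \<open>N\<close>.\<close>

lemma goursat_laplace:
  fixes v :: "real \<Rightarrow> real \<Rightarrow> complex"
  assumes cont: "continuous_on ({0..} \<times> {0..}) (\<lambda>(x, s). v x s)"
    and eq: "\<And>x s. x \<ge> 0 \<Longrightarrow> s \<ge> 0 \<Longrightarrow> v x s = v x 0 + integral {0..x} (\<lambda>t. integral {0..s} (v t))"
    and pos: "l > 0" "N \<ge> 0" "s \<ge> 0"
    and B: "\<And>r. 0 \<le> r \<Longrightarrow> r \<le> s \<Longrightarrow> cmod (v N r) \<le> B"
  defines "W \<equiv> \<lambda>r. integral {0..N} (\<lambda>x. exp (- (l * x)) *\<^sub>R v x r)"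
  shows "cmod (exp (- s / l) *\<^sub>R W s - W 0) \<le> (1 + s / l) * (2 * B / l) * exp (- (l * N))"
proof -
  have contv: "continuous_on ({0..a} \<times> {0..b}) (\<lambda>(x, s). v x s)" for a b
    by (rule continuous_on_subset[OF cont]) auto
  have cont_x: "continuous_on {0..N} (\<lambda>x. v x r)" if "r \<ge> 0" for r
    using continuous_on_section(2)[OF cont, of r] that by (auto intro: continuous_on_subset)
  \<comment> \<open>This is the boundary term at \<open>N\<close> of the integration by parts below,
    rewritten by the integral equation at \<open>x = N\<close>.\<close>
  define E where "E = (\<lambda>r. (exp (- (l * N)) / l) *\<^sub>R (v N 0 - v N r))"
  have conth: "continuous_on {0..N} (\<lambda>t. integral {0..r} (v t))" if "r \<ge> 0" for r
    using integral_continuous_on_param[of "{0..N}" 0 r v] contv by simp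
  have contW: "continuous_on {0..s} W"
  proof -
    have "continuous_on ({0..s} \<times> cbox 0 N) (\<lambda>(r, x). exp (- (l * x)) *\<^sub>R v x r)"
    proof -
      have "continuous_on ({0..s} \<times> cbox 0 N) (\<lambda>z. (\<lambda>(x, s). v x s) (snd z, fst z))"
        by (rule continuous_on_compose2[OF contv[of N s]]) (auto intro!: continuous_intros)
      then show ?thesis unfolding case_prod_beta by (intro continuous_intros) simp
    qed
    then show ?thesis unfolding W_def using integral_continuous_on_param[of "{0..s}" 0 N "\<lambda>r x. exp (- (l * x)) *\<^sub>R v x r"] by simp
  qed
  \<comment> \<open>Integration by parts trades \<open>H\<close> for its derivative \<open>h\<close>
    at the cost of a factor \<open>1 / l\<close>; swapping the order of integration then turns the
    transform of \<open>h\<close> into an integral of \<open>W\<close>.\<close>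
  have W: "W r = W 0 + (1 / l) *\<^sub>R integral {0..r} W + E r" if r: "0 \<le> r" "r \<le> s" for r
  proof -
    define h where "h = (\<lambda>t. integral {0..r} (v t))"
    define H where "H = (\<lambda>x. integral {0..x} h)"
    have ch: "continuous_on {0..N} h" unfolding h_def using conth r by simp
    have dH: "(H has_vector_derivative h x) (at x within {0..N})" if "x \<in> {0..N}" for x
      unfolding H_def using ch that by (rule integral_has_vector_derivative)
    then have cH: "continuous_on {0..N} H" by (rule continuous_on_vector_derivative)
    have "((\<lambda>x. exp (- (l * x)) *\<^sub>R H x - (exp (- (l * x)) / l) *\<^sub>R h x) has_integral
        - (exp (- (l * N)) / l) *\<^sub>R H N - - (exp (- (l * 0)) / l) *\<^sub>R H 0) {0..N}"
    proof (rule fundamental_theorem_of_calculus[where f = "\<lambda>x. - (exp (- (l * x)) / l) *\<^sub>R H x"])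
      show "((\<lambda>x. - (exp (- (l * x)) / l) *\<^sub>R H x) has_vector_derivative
         exp (- (l * x)) *\<^sub>R H x - (exp (- (l * x)) / l) *\<^sub>R h x) (at x within {0..N})" if "x \<in> {0..N}" for x
      proof -
        have "((\<lambda>x. - (exp (- (l * x)) / l)) has_real_derivative exp (- (l * x))) (at x within {0..N})"
          using pos by (auto intro!: derivative_eq_intros)
        from has_vector_derivative_scaleR[OF this dH[OF that]] show ?thesis by simp
      qed
    qed (use pos in simp)
    then have "integral {0..N} (\<lambda>x. exp (- (l * x)) *\<^sub>R H x - (exp (- (l * x)) / l) *\<^sub>R h x) = - (exp (- (l * N)) / l) *\<^sub>R H N"
      by (simp add: integral_unique H_def)
    moreover have "integral {0..N} (\<lambda>x. exp (- (l * x)) *\<^sub>R H x - (exp (- (l * x)) / l) *\<^sub>R h x) =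
        integral {0..N} (\<lambda>x. exp (- (l * x)) *\<^sub>R H x) - integral {0..N} (\<lambda>x. (exp (- (l * x)) / l) *\<^sub>R h x)"
      using pos by (intro Henstock_Kurzweil_Integration.integral_diff integrable_continuous_real continuous_intros cH ch) auto
    moreover have "integral {0..N} (\<lambda>x. exp (- (l * x)) *\<^sub>R H x) = W r - W 0"
    proof -
      have "W r - W 0 = integral {0..N} (\<lambda>x. exp (- (l * x)) *\<^sub>R v x r - exp (- (l * x)) *\<^sub>R v x 0)"
        unfolding W_def using r
        by (intro Henstock_Kurzweil_Integration.integral_diff[symmetric] integrable_continuous_real continuous_intros cont_x) auto
      also have "\<dots> = integral {0..N} (\<lambda>x. exp (- (l * x)) *\<^sub>R H x)"
      proof (rule Henstock_Kurzweil_Integration.integral_cong)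
        fix x assume "x \<in> {0..N}"
        then have "v x r - v x 0 = H x" using eq[of x r] r by (simp add: H_def h_def)
        then show "exp (- (l * x)) *\<^sub>R v x r - exp (- (l * x)) *\<^sub>R v x 0 = exp (- (l * x)) *\<^sub>R H x"
          by (simp flip: scaleR_diff_right)
      qed
      finally show ?thesis ..
    qed
    moreover have "integral {0..N} (\<lambda>x. (exp (- (l * x)) / l) *\<^sub>R h x) = (1 / l) *\<^sub>R integral {0..r} W"
    proof -
      have "integral {0..N} (\<lambda>x. (exp (- (l * x)) / l) *\<^sub>R h x) = integral {0..N} (\<lambda>x. (1 / l) *\<^sub>R (exp (- (l * x)) *\<^sub>R h x))"
        by simp
      also have "\<dots> = (1 / l) *\<^sub>R integral {0..N} (\<lambda>x. integral {0..r} (\<lambda>q. exp (- (l * x)) *\<^sub>R v x q))"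
        unfolding h_def by (simp only: Henstock_Kurzweil_Integration.integral_cmul)
      also have "integral {0..N} (\<lambda>x. integral {0..r} (\<lambda>q. exp (- (l * x)) *\<^sub>R v x q)) = integral {0..r} W"
        unfolding W_def cbox_interval[symmetric]
        by (rule integral_swap_continuous)
          (use contv[of N r] in \<open>auto simp: cbox_Pair_eq case_prod_beta intro!: continuous_intros\<close>)
      finally show ?thesis .
    qed
    moreover have "- (exp (- (l * N)) / l) *\<^sub>R H N = E r"
      using eq[of N r] r pos by (simp add: E_def H_def h_def scaleR_diff_right algebra_simps)
    ultimately have "E r = W r - W 0 - (1 / l) *\<^sub>R integral {0..r} W" by metis
    then show ?thesis by simp
  qed
  \<comment> \<open>The primitive satisfies the linear equation \<open>Z' = Z / l + W 0 + E\<close>;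
    working with it avoids differentiating \<open>E\<close>.\<close>
  define Z where "Z = (\<lambda>r. integral {0..r} W)"
  have dZ: "(Z has_vector_derivative W r) (at r within {0..s})" if "r \<in> {0..s}" for r
    unfolding Z_def using contW that by (rule integral_has_vector_derivative)
  \<comment> \<open>\<open>exp (- r / l)\<close> is the integrating factor, and the added
    \<open>l *\<^sub>R W 0\<close> absorbs the constant term.\<close>
  define \<psi> where "\<psi> = (\<lambda>r. exp (- r / l) *\<^sub>R (Z r + l *\<^sub>R W 0))"
  have d\<psi>: "(\<psi> has_vector_derivative exp (- r / l) *\<^sub>R E r) (at r within {0..s})" if "r \<in> {0..s}" for r
  proof -
    have "((\<lambda>r. exp (- r / l)) has_real_derivative - exp (- r / l) / l) (at r within {0..s})"
      using pos by (auto intro!: derivative_eq_intros)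
    moreover have "((\<lambda>r. Z r + l *\<^sub>R W 0) has_vector_derivative W r) (at r within {0..s})"
      using dZ[OF that] by (auto intro!: derivative_eq_intros)
    ultimately have "(\<psi> has_vector_derivative exp (- r / l) *\<^sub>R W r + (- exp (- r / l) / l) *\<^sub>R (Z r + l *\<^sub>R W 0)) (at r within {0..s})"
      unfolding \<psi>_def by (rule has_vector_derivative_scaleR)
    moreover have "exp (- r / l) *\<^sub>R W r + (- exp (- r / l) / l) *\<^sub>R (Z r + l *\<^sub>R W 0) = exp (- r / l) *\<^sub>R E r"
      using pos W[of r] that by (simp add: Z_def scaleR_add_right algebra_simps)
    ultimately show ?thesis by simp
  qed
  define \<eta> where "\<eta> = 2 * B / l * exp (- (l * N))"
  have E\<eta>: "cmod (E r) \<le> \<eta>" if "0 \<le> r" "r \<le> s" for r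
  proof -
    have "cmod (v N 0 - v N r) \<le> 2 * B"
      using norm_triangle_ineq4[of "v N 0" "v N r"] B[of 0] B[of r] that pos by simp
    then have "exp (- (l * N)) / l * cmod (v N 0 - v N r) \<le> exp (- (l * N)) / l * (2 * B)"
      using pos by (intro mult_left_mono) auto
    then show ?thesis using pos by (simp add: E_def \<eta>_def mult_ac)
  qed
  have \<eta>0: "\<eta> \<ge> 0" using E\<eta>[of 0] pos norm_ge_zero order_trans by blast
  have "((\<lambda>r. exp (- r / l) *\<^sub>R E r) has_integral \<psi> s - \<psi> 0) {0..s}"
    using pos d\<psi> by (intro fundamental_theorem_of_calculus) auto
  then have "cmod (\<psi> s - \<psi> 0) \<le> \<eta> * measure lborel {0..s}"
  proof (rule has_integral_bound_real[OF \<eta>0 finite.emptyI])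
    show "cmod (exp (- r / l) *\<^sub>R E r) \<le> \<eta>" if r: "r \<in> {0..s} - {}" for r
    proof -
      have "exp (- r / l) * cmod (E r) \<le> 1 * \<eta>"
        using r pos E\<eta>[of r] by (intro mult_mono) auto
      then show "cmod (exp (- r / l) *\<^sub>R E r) \<le> \<eta>" by simp
    qed
  qed
  \<comment> \<open>Returning from \<open>Z\<close> to \<open>W\<close> leaves a term
    \<open>E s\<close>, the source of the summand 1 in the factor \<open>1 + s / l\<close>.\<close>
  moreover have "\<psi> s - \<psi> 0 = l *\<^sub>R (exp (- s / l) *\<^sub>R W s - W 0 - exp (- s / l) *\<^sub>R E s)"
    using W[of s] pos by (simp add: \<psi>_def Z_def algebra_simps)
  ultimately have "l * cmod (exp (- s / l) *\<^sub>R W s - W 0 - exp (- s / l) *\<^sub>R E s) \<le> \<eta> * s"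
    using pos by simp
  then have "cmod (exp (- s / l) *\<^sub>R W s - W 0 - exp (- s / l) *\<^sub>R E s) \<le> \<eta> * s / l"
    using pos by (simp add: field_simps)
  moreover have "cmod (exp (- s / l) *\<^sub>R E s) \<le> 1 * \<eta>"
    using pos E\<eta>[of s] unfolding norm_scaleR by (intro mult_mono) auto
  ultimately have "cmod (exp (- s / l) *\<^sub>R W s - W 0) \<le> \<eta> * s / l + 1 * \<eta>"
    using norm_triangle_sub[of "exp (- s / l) *\<^sub>R W s - W 0" "exp (- s / l) *\<^sub>R E s"] by linarith
  then show ?thesis by (simp add: \<eta>_def algebra_simps add_divide_distrib)
qed

section \<open>Growth along \<open>Y\<close> and vanishing of the solution\<close>

theorem theorem1p14:
  fixes u :: "real \<times> real \<Rightarrow> complex"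
    and \<theta>1 \<theta>2 :: real
    and Y :: "real set"
  assumes "continuous_on ({0..} \<times> {..0}) u"
    and "klein_gordon_dist ({0<..} \<times> {..<0}) u"
    and "\<forall>y\<le>0. u (0, y) = 0"
    and "\<theta>1 > 0" and "\<theta>2 > 0"
    and "Y \<noteq> {}" and "Y \<subseteq> {..0}" and "0 \<in> Y"
    and "(INF y\<in>Y. ereal y) = -\<infinity>"
    and "\<exists>C::real. \<forall>x\<ge>0. \<forall>y\<in>Y. cmod (u (x, y)) \<le> C * exp (\<theta>1 * x + \<theta>2 * \<bar>y\<bar>)"
    and "\<theta>1 * \<theta>2 < 1"
  shows "\<forall>x\<ge>0. \<forall>y\<le>0. u (x, y) = 0"
proof -
  define v where "v = (\<lambda>x s. u (x, - s))"
  obtain C :: real where C: "\<And>x y. x \<ge> 0 \<Longrightarrow> y \<in> Y \<Longrightarrow> cmod (u (x, y)) \<le> C * exp (\<theta>1 * x + \<theta>2 * \<bar>y\<bar>)"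
    using assms(10) by blast
  have "0 \<le> cmod (u (0, 0))" by simp
  also have "\<dots> \<le> C" using C[of 0 0] \<open>0 \<in> Y\<close> by simp
  finally have C0: "C \<ge> 0" .
  \<comment> \<open>The midpoint of the gap that \<theta>1 * \<theta>2 < 1 leaves between \<theta>1
    and \<open>1 / \<theta>2\<close>; the transform variable \<open>l\<close> will range over the
    upper half of the gap.\<close>
  define \<alpha> where "\<alpha> = (\<theta>1 + 1 / \<theta>2) / 2"
  have "\<theta>1 < 1 / \<theta>2" using assms(5,11) by (simp add: field_simps)
  then have \<alpha>: "\<theta>1 < \<alpha>" "\<alpha> < 1 / \<theta>2" "\<alpha> > 0" using assms(4) by (auto simp: \<alpha>_def)
  \<comment> \<open>This choice makes the contraction factor \<open>1 / 2\<close> and the growth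
    constant \<open>2 * C\<close>.\<close>
  define \<beta> where "\<beta> = 2 / \<alpha>"
  have \<alpha>\<beta>: "\<beta> > 0" "\<alpha> * \<beta> = 2" using \<alpha> by (auto simp: \<beta>_def)
  have cont: "continuous_on ({0..} \<times> {0..}) (\<lambda>(x, s). v x s)"
    unfolding v_def case_prod_beta
    by (rule continuous_on_compose2[OF assms(1)]) (auto intro!: continuous_intros)
  have eq: "v x s = v x 0 + integral {0..x} (\<lambda>t. integral {0..s} (v t))" if "x \<ge> 0" "s \<ge> 0" for x s
    using klein_gordon_integral_equation[OF assms(1,2) that] assms(3) that
    by (simp add: v_def algebra_simps)
  have bound0: "cmod (v x 0) \<le> C * exp (\<theta>1 * x)" if "x \<ge> 0" for x
    using C[OF that \<open>0 \<in> Y\<close>] by (simp add: v_def)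
  have "cmod (v x 0) \<le> C * exp (\<alpha> * x)" if "x \<ge> 0" for x
  proof -
    have "C * exp (\<theta>1 * x) \<le> C * exp (\<alpha> * x)"
      using C0 \<alpha> that by (intro mult_left_mono) (auto intro: mult_right_mono)
    then show ?thesis using bound0[OF that] by linarith
  qed
  then have growth: "cmod (v x s) \<le> 2 * C * exp (\<alpha> * x + \<beta> * s)" if "x \<ge> 0" "s \<ge> 0" for x s
    using goursat_growth[OF cont eq, of C \<alpha> \<beta> x s] \<alpha> \<alpha>\<beta> that by simp
  define F where "F = (\<lambda>l s N. integral {0..real N} (\<lambda>x. exp (- (l * x)) *\<^sub>R v x s))"
  have lim: "(\<lambda>N. F l 0 N) \<longlonglongrightarrow> 0" if l: "\<alpha> < l" "l < 1 / \<theta>2" for l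
  proof (rule LIMSEQ_I)
    fix e :: real assume "e > 0"
    have l0: "l > 0" using \<alpha> l by simp
    have "1 / l - \<theta>2 > 0" using l l0 assms(5) by (simp add: field_simps)
    then have "((\<lambda>s. C / (l - \<theta>1) * exp (- ((1 / l - \<theta>2) * s))) \<longlongrightarrow> 0) at_top" by real_asymp
    then have "\<forall>\<^sub>F s in at_top. C / (l - \<theta>1) * exp (- ((1 / l - \<theta>2) * s)) < e / 2"
      using \<open>e > 0\<close> by (intro order_tendstoD) auto
    then obtain s0 where s0: "\<And>s. s \<ge> s0 \<Longrightarrow> C / (l - \<theta>1) * exp (- ((1 / l - \<theta>2) * s)) < e / 2"
      by (auto simp: eventually_at_top_linorder)
    \<comment> \<open>The point of \<open>Y\<close> is fixed before \<open>N\<close>: it makes the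
      main term small for all \<open>N\<close> at once, and the truncation error, whose constant
      depends on \<open>s\<close>, is sent to 0 afterwards.\<close>
    have "(INF y\<in>Y. ereal y) < ereal (- s0)" using assms(9) by simp
    then obtain y where y: "y \<in> Y" "y < - s0" by (auto simp: INF_less_iff)
    define s where "s = - y"
    have s: "s \<ge> 0" "s \<ge> s0" using y assms(7) by (auto simp: s_def)
    \<comment> \<open>The hypothesis on \<open>Y\<close> gives rate \<theta>2 in \<open>s\<close>,
      and the factor \<open>exp (- s / l)\<close> outweighs it because
      \<open>1 / l > \<theta>2\<close>.\<close>
    have Fs: "exp (- s / l) * cmod (F l s N) < e / 2" for N
    proof -
      have "cmod (F l s N) \<le> integral {0..real N} (\<lambda>x. C * exp (\<theta>2 * s) * exp (- ((l - \<theta>1) * x)))"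
        unfolding F_def
      proof (rule integral_norm_bound_integral)
        have "continuous_on {0..real N} (\<lambda>x. v x s)"
          using continuous_on_section(2)[OF cont, of s] s by (auto intro: continuous_on_subset)
        then show "(\<lambda>x. exp (- (l * x)) *\<^sub>R v x s) integrable_on {0..real N}"
          by (intro integrable_continuous_real continuous_intros)
        fix x assume x: "x \<in> {0..real N}"
        have "exp (- (l * x)) * cmod (v x s) \<le> exp (- (l * x)) * (C * exp (\<theta>1 * x + \<theta>2 * s))"
          using C[of x y] x y s by (intro mult_left_mono) (auto simp: v_def s_def)
        also have "\<dots> = C * exp (\<theta>2 * s) * exp (- ((l - \<theta>1) * x))"
          by (simp add: mult.assoc mult.left_commute[of _ C] algebra_simps flip: exp_add)
        finally show "cmod (exp (- (l * x)) *\<^sub>R v x s) \<le> C * exp (\<theta>2 * s) * exp (- ((l - \<theta>1) * x))"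
          by simp
      qed (intro integrable_continuous_real continuous_intros)
      also have "\<dots> = C * exp (\<theta>2 * s) * integral {0..real N} (\<lambda>x. exp (- ((l - \<theta>1) * x)))" by simp
      also have "\<dots> \<le> C * exp (\<theta>2 * s) * (exp (- ((l - \<theta>1) * 0)) / (l - \<theta>1))"
        using C0 \<alpha> l by (intro mult_left_mono integral_exp_neg_le) auto
      finally have "exp (- s / l) * cmod (F l s N) \<le> exp (- s / l) * (C * exp (\<theta>2 * s) / (l - \<theta>1))"
        by (intro mult_left_mono) auto
      also have "\<dots> = C / (l - \<theta>1) * exp (- ((1 / l - \<theta>2) * s))"
        by (simp add: algebra_simps flip: exp_add)
      also have "\<dots> < e / 2" using s by (intro s0)
      finally show ?thesis .
    qed
    \<comment> \<open>The truncation error decays because \<open>growth\<close> has rate \<alpha> in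
      the first variable and \<open>l > \<alpha>\<close>.\<close>
    have "(\<lambda>N. (1 + s / l) * (2 * (2 * C * exp (\<alpha> * real N + \<beta> * s)) / l) * exp (- (l * real N))) =
        (\<lambda>N. (1 + s / l) * (4 * C * exp (\<beta> * s) / l) * exp (- ((l - \<alpha>) * real N)))"
      by (simp add: fun_eq_iff exp_add exp_diff exp_minus field_simps)
    also have "\<dots> \<longlonglongrightarrow> 0" using l by real_asymp
    finally have "\<forall>\<^sub>F N in sequentially. (1 + s / l) * (2 * (2 * C * exp (\<alpha> * real N + \<beta> * s)) / l) * exp (- (l * real N)) < e / 2"
      using \<open>e > 0\<close> by (intro order_tendstoD) auto
    then obtain N0 where N0: "\<And>N. N \<ge> N0 \<Longrightarrow> (1 + s / l) * (2 * (2 * C * exp (\<alpha> * real N + \<beta> * s)) / l) * exp (- (l * real N)) < e / 2"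
      by (auto simp: eventually_sequentially)
    have "cmod (F l 0 N) < e" if "N \<ge> N0" for N
    proof -
      have "cmod (v (real N) r) \<le> 2 * C * exp (\<alpha> * real N + \<beta> * s)" if "0 \<le> r" "r \<le> s" for r
      proof -
        have "2 * C * exp (\<alpha> * real N + \<beta> * r) \<le> 2 * C * exp (\<alpha> * real N + \<beta> * s)"
          using C0 \<alpha>\<beta> that by (intro mult_left_mono) auto
        then show ?thesis using growth[of "real N" r] that by simp
      qed
      then have "cmod (exp (- s / l) *\<^sub>R F l s N - F l 0 N) \<le>
          (1 + s / l) * (2 * (2 * C * exp (\<alpha> * real N + \<beta> * s)) / l) * exp (- (l * real N))"
        unfolding F_def using l0 s by (intro goursat_laplace[OF cont eq]) auto
      then have "cmod (exp (- s / l) *\<^sub>R F l s N - F l 0 N) < e / 2" using N0[OF that] by linarith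
      then show ?thesis
        using Fs[of N] norm_triangle_ineq4[of "exp (- s / l) *\<^sub>R F l s N" "exp (- s / l) *\<^sub>R F l s N - F l 0 N"]
        by simp
    qed
    then show "\<exists>N0. \<forall>N\<ge>N0. cmod (F l 0 N - 0) < e" by auto
  qed
  have "v x 0 = 0" if "x \<ge> 0" for x
  proof (rule laplace_zero[of "\<lambda>x. v x 0" C \<theta>1 \<alpha> "1 / \<theta>2"])
    show "continuous_on {0..} (\<lambda>x. v x 0)" by (rule continuous_on_section(2)[OF cont]) simp
  qed (use lim bound0 \<alpha> that in \<open>auto simp: F_def\<close>)
  \<comment> \<open>With zero boundary values the growth estimate holds with constant 0, which is
    uniqueness for the Goursat problem.\<close>
  then have "cmod (v x s) \<le> 0 / (1 - 1 / (\<alpha> * \<beta>)) * exp (\<alpha> * x + \<beta> * s)" if "x \<ge> 0" "s \<ge> 0" for x s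
    using \<alpha> \<alpha>\<beta> that by (intro goursat_growth[OF cont eq]) auto
  then have "v x s = 0" if "x \<ge> 0" "s \<ge> 0" for x s using that by force
  from this[of _ "- _"] show ?thesis by (auto simp: v_def)
qed

end
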